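(* (Almost-sure convergence.) Suppose Assumption 1 holds, with a common $\delta\in[0,1/2)$ in (i.b), (ii.c), (iii.a) and (iii.b). Then the estimation error $e_0(t)=X(t)-\mathbf{1}_N\otimes\theta$ of the event-triggered distributed estimation algorithm satisfies $$\mathbb{P}\Big\{\lim_{t\to\infty}\frac{e_0(t)}{\alpha^{\delta}(t)}=0\Big\}=1.$$
   Context: Graph: $\mathcal{G}$ is a weighted digraph on $\mathcal{V}=\{1,\dots,N\}$ with adjacency matrix $\mathcal{A}=[a_{i,j}]$, $a_{i,j}\ge0$, $a_{i,i}=0$; $a_{i,j}>0$ means a link from $j$ to $i$. $\mathcal{N}_i=\{j:a_{i,j}>0\}$ (parents of $i$), $\mathcal{N}_i^c=\{j:a_{j,i}>0\}$ (children of $i$). Laplacian $\mathcal{L}=\mathcal{D}-\mathcal{A}$, $\mathcal{D}=\mathrm{diag}\{\sum_ja_{1,j},\dots,\sum_j a_{N,j}\}$, $\bar{\mathcal{L}}=(\mathcal{L}+\mathcal{L}^{\sf T})/2$. Model: unknown $\theta\in\mathbb{R}^M$; sensor $i$ measures $y_i(t)=H_i(t)\theta+v_i(t)$, $H_i(t)\in\mathbb{R}^{m_i\times M}$ known (random), $v_i(t)\in\mathbb{R}^{m_i}$ noise. $\bar D_H(t)=\mathrm{blockdiag}\{H_1^{\sf T}(t),\dots,H_N^{\sf T}(t)\}$, $V(t)=[v_1^{\sf T}(t),\dots,v_N^{\sf T}(t)]^{\sf T}$, $\mathcal{F}(t)=\sigma(\bar D_H(s),V(s),0\le s\le t)$,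 $\mathcal{F}(-1)=\{\emptyset,\Omega\}$. Algorithm: each sensor $i$ has a deterministic fixed initial estimate $x_i(0)\in\mathbb{R}^M$, deterministic step sizes $\alpha_i(t)>0$ and thresholds $f_i(t)\ge0$. Let $\hat x_i(t)$ denote the last estimate sent by sensor $i$ up to time $t$: $\hat x_i(0)=x_i(0)$ (sensor $i$ sends at $t=0$), and for $t\ge1$, if $\|x_i(t)-\hat x_i(t-1)\|>f_i(t)$ then sensor $i$ sends (an event is triggered) and $\hat x_i(t)=x_i(t)$, otherwise $\hat x_i(t)=\hat x_i(t-1)$. The update is $$x_i(t+1)=x_i(t)+\alpha_i(t)H_i^{\sf T}(t)(y_i(t)-H_i(t)x_i(t))+\alpha_i(t)\sum_{j\in\mathcal{N}_i}a_{i,j}(\hat x_j(t)-x_i(t)).$$ $X(t)=[x_1^{\sf T}(t),\dots,x_N^{\sf T}(t)]^{\sf T}$; $f_{\max}(t)=\max_i f_i(t)$, $f_{\min}(t)=\min_i f_i(t)$. Assumption 1: (i.a) there is a deterministic sequence $\{\alpha(t)\}$ with $\alpha_i(t)/\alpha(t)\to1$ for all $i$, $\alpha(t)>0$, $\alpha(t)\to0$, $\sum_t\alpha(t)=\infty$, and $1/\alpha(t+1)-1/\alpha(t)\to\alpha_0\ge0$. (i.b) $\sum_{t}\alpha(t)^{2(1-\delta)}<\infty$ for some $\delta\in[0,1/2)$. (ii.a) $\{\bar D_H(t)\}$ and $\{V(t)\}$ are independent sequences. (ii.b) $\{V(t)\}$ is a martingale difference sequence w.r.t. $\{\mathcal{F}(t)\}$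 and for some $\rho>2$, $\sup_t\mathbb{E}\{\|V(t)\|^\rho\mid\mathcal{F}(t-1)\}=c_V<\infty$ a.s. (ii.c) $\sup_t\|\bar D_H(t)\|^2\le D<\infty$ a.s., and there exist $h\in\mathbb{N}^+$, $\lambda>0$ such that for all $m\in\mathbb{N}$ and some $\delta\in[0,1/2)$, $\lambda_{\min}\big[\sum_{t=mh}^{(m+1)h-1}\mathbb{E}\{\bar{\mathcal{L}}\otimes I_M+\bar D_H(t)\bar D_H^{\sf T}(t)\mid\mathcal{F}(mh-1)\}\big]\ge\lambda+h\alpha_0\delta$ a.s. (iii.a) $f_{\max}(t)/\alpha^\delta(t)\to0$ for some $\delta\in[0,1/2)$. (iii.b) $\sum_t\alpha(t)^{1-\delta}f_{\max}(t)<\infty$ for some $\delta\in[0,1/2)$. *)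

theory Defs
  imports "HOL-Probability.Probability"
begin

definition kron :: "real^'n::finite^'n \<Rightarrow> real^'m^'m \<Rightarrow> real^('n \<times> 'm)^('n \<times> 'm)" where
  "kron A B = (\<chi> p q. A $ fst p $ fst q * B $ snd p $ snd q)"

text \<open>Graph Laplacian L = D - A of the weighted digraph with adjacency a (a i j > 0: link j to i),
  and its symmetrization (L + L^T)/2.\<close>
definition laplacian :: "('n::finite \<Rightarrow> 'n \<Rightarrow> real) \<Rightarrow> real^'n^'n" where
  "laplacian a = (\<chi> i j. (if i = j then (\<Sum>k\<in>UNIV. a i k) else 0) - a i j)"

definition sym_laplacian :: "('n::finite \<Rightarrow> 'n \<Rightarrow> real) \<Rightarrow> real^'n^'n" where
  "sym_laplacian a = (1/2) *\<^sub>R (laplacian a + transpose (laplacian a))"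

definition lambda_min :: "real^'k^'k \<Rightarrow> real" where
  "lambda_min A = Min {c. \<exists>v. v \<noteq> 0 \<and> A *v v = c *\<^sub>R v}"

definition mat_norm :: "real^'c^'r \<Rightarrow> real" where
  "mat_norm A = onorm (\<lambda>x. A *v x)"

text \<open>The stacked matrix blockdiag{H_1^T,...,H_N^T}: measurement rows are indexed by a finite
  type 'r; own r is the sensor owning row r, and row r of H_{own r} is Hr r.\<close>
definition DH_mat :: "('r::finite \<Rightarrow> 'n::finite) \<Rightarrow> ('r \<Rightarrow> real^'m::finite) \<Rightarrow> real^'r^('n \<times> 'm)" where
  "DH_mat own Hr = (\<chi> p r. if own r = fst p then Hr r $ snd p else 0)"

text \<open>Pre-t sigma-algebra sigma(Z s, W s : s < t); so pre_filt M Z W t is F(t-1),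
  and pre_filt M Z W 0 = F(-1) is trivial.\<close>
definition pre_filt :: "'a measure \<Rightarrow> (nat \<Rightarrow> 'a \<Rightarrow> 'b::topological_space)
    \<Rightarrow> (nat \<Rightarrow> 'a \<Rightarrow> 'c::topological_space) \<Rightarrow> nat \<Rightarrow> 'a measure" where
  "pre_filt M Z W t = sigma (space M)
     ((\<Union>s<t. {Z s -` A \<inter> space M | A. A \<in> sets borel}) \<union>
      (\<Union>s<t. {W s -` B \<inter> space M | B. B \<in> sets borel}))"

definition cond_exp_mat :: "'a measure \<Rightarrow> 'a measure \<Rightarrow> ('a \<Rightarrow> real^'k^'l) \<Rightarrow> 'a \<Rightarrow> real^'k^'l" where
  "cond_exp_mat M F A = (\<lambda>\<omega>. \<chi> p q. real_cond_exp M F (\<lambda>\<omega>'. A \<omega>' $ p $ q) \<omega>)"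

end

theory Submission
  imports Defs
begin

text \<open>Almost every path is treated deterministically. The scaled error \<open>z(t) = e\<^sub>0(t) / \<alpha>(t)\<^sup>\<delta>\<close>
  satisfies \<open>z(t+1) = z(t) - \<alpha>(t) B(t) z(t) + n(t) + o(\<alpha>(t)) (1 + |z(t)|)\<close> with
  \<open>B = L \<otimes> I + D\<^sub>H D\<^sub>H\<^sup>T - \<alpha>\<^sub>0 \<delta> I\<close>; the triggering error enters the last term because
  \<open>f\<^sub>m\<^sub>a\<^sub>x = o(\<alpha>\<^sup>\<delta>)\<close>. Two random series converge almost surely as square-summable martingale
  difference series: the noise \<open>\<Sum> n(t)\<close>, and \<open>\<Sum> \<alpha>(t) (B(t) - \<Lambda>(t))\<close>, where \<open>\<Lambda>\<close> is the
  conditional block average of \<open>B\<close>. By excitation \<open>y \<bullet> \<Lambda> y \<ge> (\<lambda>/h) |y|\<^sup>2\<close>; the skew part of the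
  Laplacian does not matter. Absorbing the tails of both series into \<open>z\<close> leaves a contraction
  \<open>|w(t+1)| \<le> (1 - c \<alpha>(t)) |w(t)| + o(\<alpha>(t))\<close>, and \<open>\<Sum> \<alpha> = \<infinity>\<close> forces \<open>w \<rightarrow> 0\<close>.\<close>

section \<open>Square-summable martingale difference series\<close>

text \<open>Excitation bounds only a conditional average over \<open>h\<close> steps, so a single
  \<open>B(t)\<close> may fail to be coercive. Deviations from the prediction made at the start of a
  block are centred only as whole block sums; hence that martingale runs over block indices, and the
  step size is frozen at the block start at a summable cost of order
  \<open>\<alpha>(t)\<^sup>2\<close>. The noise poses a different obstacle: the information up to
  \<open>t - 1\<close> does not contain \<open>D\<^sub>H(t)\<close>, so the martingale property of
  \<open>V\<close> alone does not centre \<open>D\<^sub>H(t) V(t)\<close>; independence of the two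
  whole sequences repairs this. Dividing by \<open>\<alpha>(t)\<^sup>\<delta>\<close> has two
  effects. It multiplies the state by \<open>(\<alpha>(t) / \<alpha>(t+1))\<^sup>\<delta> = 1 +
  \<alpha>\<^sub>0 \<delta> \<alpha>(t) + o(\<alpha>(t))\<close>, a drift paid for by the extra
  \<open>h \<alpha>\<^sub>0 \<delta>\<close> in the excitation bound, and it raises the noise
  coefficients to order \<open>\<alpha>(t)\<close> to the power \<open>1 - \<delta>\<close>, whose
  squares are still summable. Since the tails are used path by path, no moment of the error is ever
  estimated.\<close>

lemma integrable_mult_of_square_integrable:
  fixes f g :: "'a \<Rightarrow> real"
  assumes [measurable]: "f \<in> borel_measurable M" "g \<in> borel_measurable M"
    and "integrable M (\<lambda>\<omega>. (f \<omega>)\<^sup>2)" "integrable M (\<lambda>\<omega>. (g \<omega>)\<^sup>2)"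
  shows "integrable M (\<lambda>\<omega>. f \<omega> * g \<omega>)"
proof (rule Bochner_Integration.integrable_bound)
  show "integrable M (\<lambda>\<omega>. (f \<omega>)\<^sup>2 + (g \<omega>)\<^sup>2)" using assms by simp
  show "AE \<omega> in M. norm (f \<omega> * g \<omega>) \<le> norm ((f \<omega>)\<^sup>2 + (g \<omega>)\<^sup>2)"
  proof (rule AE_I2)
    fix \<omega>
    have "2 * (\<bar>f \<omega>\<bar> * \<bar>g \<omega>\<bar>) \<le> (f \<omega>)\<^sup>2 + (g \<omega>)\<^sup>2"
      using sum_squares_bound[of "\<bar>f \<omega>\<bar>" "\<bar>g \<omega>\<bar>"] by (simp add: algebra_simps)
    then have "\<bar>f \<omega>\<bar> * \<bar>g \<omega>\<bar> \<le> (f \<omega>)\<^sup>2 + (g \<omega>)\<^sup>2"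
      using mult_nonneg_nonneg[OF abs_ge_zero[of "f \<omega>"] abs_ge_zero[of "g \<omega>"]] by linarith
    then show "norm (f \<omega> * g \<omega>) \<le> norm ((f \<omega>)\<^sup>2 + (g \<omega>)\<^sup>2)"
      by (simp add: abs_mult)
  qed
qed simp

lemma (in prob_space) expectation_mult_eq_zero:
  fixes f g :: "'a \<Rightarrow> real"
  assumes "subalgebra M F" "f \<in> borel_measurable F" "g \<in> borel_measurable M"
    and "integrable M (\<lambda>\<omega>. f \<omega> * g \<omega>)"
    and "AE \<omega> in M. real_cond_exp M F g \<omega> = 0"
  shows "expectation (\<lambda>\<omega>. f \<omega> * g \<omega>) = 0"
proof -
  interpret finite_measure_subalgebra M F
    by unfold_locales (use assms in auto)
  have "expectation (\<lambda>\<omega>. f \<omega> * real_cond_exp M F g \<omega>) = expectation (\<lambda>\<omega>. f \<omega> * g \<omega>)"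
    by (rule real_cond_exp_intg) (use assms in auto)
  moreover have "expectation (\<lambda>\<omega>. f \<omega> * real_cond_exp M F g \<omega>) = expectation (\<lambda>\<omega>. 0)"
    using assms by (intro integral_cong_AE) (auto intro: measurable_from_subalg)
  ultimately show ?thesis by simp
qed

text \<open>Martingale differences; the \<open>\<sigma>\<close>-algebra \<open>F t\<close> holds the information strictly before time \<open>t\<close>.\<close>

locale mds = prob_space M for M :: "'a measure" +
  fixes X :: "nat \<Rightarrow> 'a \<Rightarrow> real" and F :: "nat \<Rightarrow> 'a measure"
  assumes subalg: "\<And>t. subalgebra M (F t)"
    and meas: "\<And>t. X t \<in> borel_measurable M"
    and adapted: "\<And>s t. s < t \<Longrightarrow> X s \<in> borel_measurable (F t)"
    and square_int: "\<And>t. integrable M (\<lambda>\<omega>. (X t \<omega>)\<^sup>2)"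
    and cond_zero: "\<And>t. AE \<omega> in M. real_cond_exp M (F t) (X t) \<omega> = 0"
begin

text \<open>The band condition at time \<open>t\<close> involves only \<open>X s\<close> with
  \<open>s < t\<close>, so it is known to \<open>F t\<close> and stopped increments remain
  martingale differences. Increments vanish after the first exit, which stands in for an explicit
  stopping time.\<close>

definition stopped :: "real \<Rightarrow> nat \<Rightarrow> nat \<Rightarrow> 'a \<Rightarrow> real" where
  "stopped \<epsilon> a t \<omega> = (if \<forall>k\<in>{a..t}. \<bar>\<Sum>s\<in>{a..<k}. X s \<omega>\<bar> < \<epsilon> then X t \<omega> else 0)"

lemma measurable_stopped:
  assumes "\<And>s. s \<le> t \<Longrightarrow> X s \<in> borel_measurable N"
  shows "stopped \<epsilon> a t \<in> borel_measurable N"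
proof -
  have [measurable]: "(\<lambda>\<omega>. \<Sum>s\<in>{a..<k}. X s \<omega>) \<in> borel_measurable N" if "k \<in> {a..t}" for k
    using that by (intro borel_measurable_sum assms) auto
  have [measurable]: "X t \<in> borel_measurable N" by (simp add: assms)
  show ?thesis unfolding stopped_def by measurable
qed

lemma stopped_square_le: "(stopped \<epsilon> a t \<omega>)\<^sup>2 \<le> (X t \<omega>)\<^sup>2"
  by (simp add: stopped_def)

lemma integrable_stopped_square: "integrable M (\<lambda>\<omega>. (stopped \<epsilon> a t \<omega>)\<^sup>2)"
  using stopped_square_le
  by (intro Bochner_Integration.integrable_bound[OF square_int[of t]])
     (auto intro!: borel_measurable_power measurable_stopped meas)

lemma stopped_orthogonal:
  assumes "s < t"
  shows "expectation (\<lambda>\<omega>. stopped \<epsilon> a s \<omega> * stopped \<epsilon> a t \<omega>) = 0"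
proof -
  \<comment> \<open>The band indicator of the later factor moves to the earlier one:
    \<open>g\<close> is \<open>F t\<close>-measurable and meets the raw increment
    \<open>X t\<close>, whose conditional mean is zero.\<close>
  define g where "g \<omega> = (if \<forall>k\<in>{a..t}. \<bar>\<Sum>s\<in>{a..<k}. X s \<omega>\<bar> < \<epsilon> then stopped \<epsilon> a s \<omega> else 0)" for \<omega>
  have [measurable]: "stopped \<epsilon> a s \<in> borel_measurable (F t)"
    using assms by (intro measurable_stopped adapted) auto
  have [measurable]: "(\<lambda>\<omega>. \<Sum>s\<in>{a..<k}. X s \<omega>) \<in> borel_measurable (F t)" if "k \<in> {a..t}" for k
    using that by (intro borel_measurable_sum adapted) auto
  have g: "g \<in> borel_measurable (F t)" unfolding g_def by measurable
  have eq: "(\<lambda>\<omega>. stopped \<epsilon> a s \<omega> * stopped \<epsilon> a t \<omega>) = (\<lambda>\<omega>. g \<omega> * X t \<omega>)"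
    by (auto simp: g_def stopped_def)
  have "integrable M (\<lambda>\<omega>. stopped \<epsilon> a s \<omega> * stopped \<epsilon> a t \<omega>)"
    by (intro integrable_mult_of_square_integrable integrable_stopped_square measurable_stopped meas)
  then show ?thesis
    unfolding eq by (intro expectation_mult_eq_zero[OF subalg g meas _ cond_zero])
qed

lemma expectation_stopped_sum_square:
  "integrable M (\<lambda>\<omega>. (\<Sum>t\<in>{a..<b}. stopped \<epsilon> a t \<omega>)\<^sup>2)"
  "expectation (\<lambda>\<omega>. (\<Sum>t\<in>{a..<b}. stopped \<epsilon> a t \<omega>)\<^sup>2) \<le> (\<Sum>t\<in>{a..<b}. expectation (\<lambda>\<omega>. (X t \<omega>)\<^sup>2))"
proof -
  have int: "integrable M (\<lambda>\<omega>. stopped \<epsilon> a s \<omega> * stopped \<epsilon> a t \<omega>)" for s t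
    by (intro integrable_mult_of_square_integrable integrable_stopped_square measurable_stopped meas)
  have sq: "(\<lambda>\<omega>. (\<Sum>t\<in>{a..<b}. stopped \<epsilon> a t \<omega>)\<^sup>2) =
      (\<lambda>\<omega>. \<Sum>s\<in>{a..<b}. \<Sum>t\<in>{a..<b}. stopped \<epsilon> a s \<omega> * stopped \<epsilon> a t \<omega>)"
    by (simp add: power2_eq_square sum_product)
  show "integrable M (\<lambda>\<omega>. (\<Sum>t\<in>{a..<b}. stopped \<epsilon> a t \<omega>)\<^sup>2)"
    unfolding sq using int by auto
  have zero: "expectation (\<lambda>\<omega>. stopped \<epsilon> a s \<omega> * stopped \<epsilon> a t \<omega>) = 0" if "s \<noteq> t" for s t
    using stopped_orthogonal[of s t] stopped_orthogonal[of t s] that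
    by (cases s t rule: linorder_cases) (simp_all add: mult.commute)
  have "expectation (\<lambda>\<omega>. (\<Sum>t\<in>{a..<b}. stopped \<epsilon> a t \<omega>)\<^sup>2) =
      (\<Sum>s\<in>{a..<b}. \<Sum>t\<in>{a..<b}. expectation (\<lambda>\<omega>. stopped \<epsilon> a s \<omega> * stopped \<epsilon> a t \<omega>))"
    unfolding sq using int by (simp add: Bochner_Integration.integral_sum)
  also have "\<dots> = (\<Sum>s\<in>{a..<b}. expectation (\<lambda>\<omega>. (stopped \<epsilon> a s \<omega>)\<^sup>2))"
  proof (rule sum.cong[OF refl])
    fix s assume s: "s \<in> {a..<b}"
    have "(\<Sum>t\<in>{a..<b}. expectation (\<lambda>\<omega>. stopped \<epsilon> a s \<omega> * stopped \<epsilon> a t \<omega>)) =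
        (\<Sum>t\<in>{a..<b}. if t = s then expectation (\<lambda>\<omega>. (stopped \<epsilon> a s \<omega>)\<^sup>2) else 0)"
      by (rule sum.cong) (auto simp: zero power2_eq_square)
    then show "(\<Sum>t\<in>{a..<b}. expectation (\<lambda>\<omega>. stopped \<epsilon> a s \<omega> * stopped \<epsilon> a t \<omega>)) =
        expectation (\<lambda>\<omega>. (stopped \<epsilon> a s \<omega>)\<^sup>2)"
      using s by simp
  qed
  also have "\<dots> \<le> (\<Sum>t\<in>{a..<b}. expectation (\<lambda>\<omega>. (X t \<omega>)\<^sup>2))"
    by (intro sum_mono integral_mono integrable_stopped_square square_int stopped_square_le)
  finally show "expectation (\<lambda>\<omega>. (\<Sum>t\<in>{a..<b}. stopped \<epsilon> a t \<omega>)\<^sup>2)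
      \<le> (\<Sum>t\<in>{a..<b}. expectation (\<lambda>\<omega>. (X t \<omega>)\<^sup>2))" .
qed

text \<open>Once the partial sums have left the band, the stopped sum stays outside it, so Chebyshev's inequality
  for the stopped sum controls the whole running maximum.\<close>

lemma stopped_sum_cases:
  assumes "a \<le> b"
  shows "(\<forall>k\<in>{a..b}. \<bar>\<Sum>s\<in>{a..<k}. X s \<omega>\<bar> < \<epsilon>) \<and>
      (\<Sum>t\<in>{a..<b}. stopped \<epsilon> a t \<omega>) = (\<Sum>t\<in>{a..<b}. X t \<omega>) \<or>
    (\<exists>k\<in>{a..b}. \<epsilon> \<le> \<bar>\<Sum>s\<in>{a..<k}. X s \<omega>\<bar>) \<and> \<epsilon> \<le> \<bar>\<Sum>t\<in>{a..<b}. stopped \<epsilon> a t \<omega>\<bar>"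
  using assms
proof (induction b rule: dec_induct)
  case base
  show ?case by auto
next
  case (step b)
  from step.IH show ?case
  proof
    assume IH: "(\<forall>k\<in>{a..b}. \<bar>\<Sum>s\<in>{a..<k}. X s \<omega>\<bar> < \<epsilon>) \<and>
      (\<Sum>t\<in>{a..<b}. stopped \<epsilon> a t \<omega>) = (\<Sum>t\<in>{a..<b}. X t \<omega>)"
    then have "(\<Sum>t\<in>{a..<Suc b}. stopped \<epsilon> a t \<omega>) = (\<Sum>t\<in>{a..<Suc b}. X t \<omega>)"
      using step.hyps by (simp add: stopped_def)
    \<comment> \<open>If \<open>Suc b\<close> is the first exit, the increment \<open>X b\<close>
      was still counted, so the stopped sum equals the true sum and is outside the band as
      well.\<close>
    then show ?thesis using IH step.hyps
      by (cases "\<bar>\<Sum>s\<in>{a..<Suc b}. X s \<omega>\<bar> < \<epsilon>") (auto simp: le_Suc_eq not_less intro!: bexI[of _ "Suc b"])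
  next
    assume IH: "(\<exists>k\<in>{a..b}. \<epsilon> \<le> \<bar>\<Sum>s\<in>{a..<k}. X s \<omega>\<bar>) \<and> \<epsilon> \<le> \<bar>\<Sum>t\<in>{a..<b}. stopped \<epsilon> a t \<omega>\<bar>"
    then have "stopped \<epsilon> a b \<omega> = 0" by (force simp: stopped_def not_less)
    then show ?thesis using IH step.hyps by (auto simp: le_Suc_eq)
  qed
qed

lemma maximal_inequality:
  assumes "0 < \<epsilon>"
  shows "prob {\<omega>\<in>space M. \<exists>k\<in>{a..b}. \<epsilon> \<le> \<bar>\<Sum>s\<in>{a..<k}. X s \<omega>\<bar>}
    \<le> (\<Sum>t\<in>{a..<b}. expectation (\<lambda>\<omega>. (X t \<omega>)\<^sup>2)) / \<epsilon>\<^sup>2"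
proof (cases "a \<le> b")
  case True
  note [measurable] = meas
  let ?S = "\<lambda>\<omega>. \<Sum>t\<in>{a..<b}. stopped \<epsilon> a t \<omega>"
  have [measurable]: "?S \<in> borel_measurable M"
    by (intro borel_measurable_sum measurable_stopped meas)
  have "prob {\<omega>\<in>space M. \<exists>k\<in>{a..b}. \<epsilon> \<le> \<bar>\<Sum>s\<in>{a..<k}. X s \<omega>\<bar>} \<le> prob {\<omega>\<in>space M. \<epsilon>\<^sup>2 \<le> (?S \<omega>)\<^sup>2}"
  proof (rule finite_measure_mono)
    show "{\<omega>\<in>space M. \<exists>k\<in>{a..b}. \<epsilon> \<le> \<bar>\<Sum>s\<in>{a..<k}. X s \<omega>\<bar>} \<subseteq> {\<omega>\<in>space M. \<epsilon>\<^sup>2 \<le> (?S \<omega>)\<^sup>2}"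
    proof safe
      fix \<omega> k assume "k \<in> {a..b}" "\<epsilon> \<le> \<bar>\<Sum>s\<in>{a..<k}. X s \<omega>\<bar>"
      then have "\<epsilon> \<le> \<bar>?S \<omega>\<bar>" using stopped_sum_cases[OF True, of \<omega> \<epsilon>] by force
      then have "\<epsilon>\<^sup>2 \<le> \<bar>?S \<omega>\<bar>\<^sup>2" using assms by (intro power_mono) auto
      then show "\<epsilon>\<^sup>2 \<le> (?S \<omega>)\<^sup>2" by simp
    qed
  qed measurable
  also have "\<dots> \<le> expectation (\<lambda>\<omega>. (?S \<omega>)\<^sup>2) / \<epsilon>\<^sup>2"
    using integral_Markov_inequality_measure[OF expectation_stopped_sum_square(1)[of \<epsilon> a b], of "{}" "\<epsilon>\<^sup>2"] assms
    by simp
  also have "\<dots> \<le> (\<Sum>t\<in>{a..<b}. expectation (\<lambda>\<omega>. (X t \<omega>)\<^sup>2)) / \<epsilon>\<^sup>2"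
    using expectation_stopped_sum_square(2)[of \<epsilon> a b] by (intro divide_right_mono) auto
  finally show ?thesis .
qed simp

lemma maximal_inequality_infinite:
  assumes "0 < \<epsilon>" and sm: "summable (\<lambda>t. expectation (\<lambda>\<omega>. (X t \<omega>)\<^sup>2))"
  shows "prob {\<omega>\<in>space M. \<exists>k\<ge>a. \<epsilon> \<le> \<bar>\<Sum>s\<in>{a..<k}. X s \<omega>\<bar>}
    \<le> (\<Sum>t. expectation (\<lambda>\<omega>. (X (t + a) \<omega>)\<^sup>2)) / \<epsilon>\<^sup>2"
proof -
  note [measurable] = meas
  let ?A = "\<lambda>b. {\<omega>\<in>space M. \<exists>k\<in>{a..b}. \<epsilon> \<le> \<bar>\<Sum>s\<in>{a..<k}. X s \<omega>\<bar>}"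
  have U: "{\<omega>\<in>space M. \<exists>k\<ge>a. \<epsilon> \<le> \<bar>\<Sum>s\<in>{a..<k}. X s \<omega>\<bar>} = (\<Union>b. ?A b)"
    by (auto, meson atLeastAtMost_iff order.refl)
  have "(\<lambda>b. prob (?A b)) \<longlonglongrightarrow> prob (\<Union>b. ?A b)"
  proof (rule finite_Lim_measure_incseq)
    show "range ?A \<subseteq> events" by auto
    show "incseq ?A" unfolding incseq_def by fastforce
  qed
  moreover have "prob (?A b) \<le> (\<Sum>t. expectation (\<lambda>\<omega>. (X (t + a) \<omega>)\<^sup>2)) / \<epsilon>\<^sup>2" for b
  proof -
    have "(\<Sum>t\<in>{a..<b}. expectation (\<lambda>\<omega>. (X t \<omega>)\<^sup>2)) = (\<Sum>t<b-a. expectation (\<lambda>\<omega>. (X (t + a) \<omega>)\<^sup>2))"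
      by (rule sum.reindex_bij_witness[of _ "\<lambda>t. t + a" "\<lambda>t. t - a"]) auto
    also have "\<dots> \<le> (\<Sum>t. expectation (\<lambda>\<omega>. (X (t + a) \<omega>)\<^sup>2))"
      using sm by (intro sum_le_suminf summable_ignore_initial_segment[of _ a]) auto
    finally show ?thesis using maximal_inequality[OF assms(1), of a b]
      by (meson divide_right_mono order_trans zero_le_power2)
  qed
  ultimately show ?thesis unfolding U by (intro LIMSEQ_le_const2) auto
qed

text \<open>The probability that the sums started at \<open>a\<close> ever leave a band tends to
  zero with growing \<open>a\<close>, so for countably many widths almost every path has a start
  after which it stays inside. This is a Cauchy property; no limit variable has to be
  constructed.\<close>

theorem AE_summable:
  assumes sm: "summable (\<lambda>t. expectation (\<lambda>\<omega>. (X t \<omega>)\<^sup>2))"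
  shows "AE \<omega> in M. summable (\<lambda>t. X t \<omega>)"
proof -
  note [measurable] = meas
  have "AE \<omega> in M. \<exists>a. \<forall>k\<ge>a. \<bar>\<Sum>s\<in>{a..<k}. X s \<omega>\<bar> < \<epsilon>" if "0 < \<epsilon>" for \<epsilon>
  proof -
    let ?B = "\<lambda>a. {\<omega>\<in>space M. \<exists>k\<ge>a. \<epsilon> \<le> \<bar>\<Sum>s\<in>{a..<k}. X s \<omega>\<bar>}"
    let ?N = "{\<omega>\<in>space M. \<forall>a. \<exists>k\<ge>a. \<epsilon> \<le> \<bar>\<Sum>s\<in>{a..<k}. X s \<omega>\<bar>}"
    have N[measurable]: "?N \<in> events" by measurable
    have "(\<lambda>a. (\<Sum>t. expectation (\<lambda>\<omega>. (X (t + a) \<omega>)\<^sup>2)) / \<epsilon>\<^sup>2) \<longlonglongrightarrow> 0 / \<epsilon>\<^sup>2"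
      using that by (intro tendsto_divide suminf_exist_split2[OF sm] tendsto_const) auto
    moreover have "prob ?N \<le> (\<Sum>t. expectation (\<lambda>\<omega>. (X (t + a) \<omega>)\<^sup>2)) / \<epsilon>\<^sup>2" for a
    proof -
      have "prob ?N \<le> prob (?B a)" by (intro finite_measure_mono) auto
      then show ?thesis using maximal_inequality_infinite[OF that sm, of a] by simp
    qed
    ultimately have "prob ?N \<le> 0" by (intro LIMSEQ_le_const[of _ "0 / \<epsilon>\<^sup>2", simplified]) auto
    then have "prob ?N = 0" by (simp add: measure_le_0_iff)
    then have "AE \<omega> in M. \<omega> \<notin> ?N" using N by (simp add: prob_eq_0)
    then show ?thesis
    proof (rule AE_mp, intro AE_I2 impI)
      fix \<omega> assume "\<omega> \<in> space M" "\<omega> \<notin> ?N"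
      then obtain a where "\<forall>k\<ge>a. \<not> \<epsilon> \<le> \<bar>\<Sum>s\<in>{a..<k}. X s \<omega>\<bar>" by blast
      then show "\<exists>a. \<forall>k\<ge>a. \<bar>\<Sum>s\<in>{a..<k}. X s \<omega>\<bar> < \<epsilon>" unfolding not_le by blast
    qed
  qed
  then have "AE \<omega> in M. \<forall>n::nat. \<exists>a. \<forall>k\<ge>a. \<bar>\<Sum>s\<in>{a..<k}. X s \<omega>\<bar> < inverse (real (Suc n))"
    unfolding AE_all_countable by simp
  then show ?thesis
  proof (rule AE_mp, intro AE_I2 impI)
    fix \<omega> assume *: "\<forall>n::nat. \<exists>a. \<forall>k\<ge>a. \<bar>\<Sum>s\<in>{a..<k}. X s \<omega>\<bar> < inverse (real (Suc n))"
    show "summable (\<lambda>t. X t \<omega>)"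
      unfolding summable_Cauchy
    proof (intro allI impI)
      fix e :: real assume "0 < e"
      then obtain n where n: "inverse (real (Suc n)) < e / 2"
        using reals_Archimedean[of "e / 2"] by auto
      obtain a where a: "\<forall>k\<ge>a. \<bar>\<Sum>s\<in>{a..<k}. X s \<omega>\<bar> < inverse (real (Suc n))"
        using * by blast
      have "norm (\<Sum>s\<in>{l..<k}. X s \<omega>) < e" if "a \<le> l" for l k
      proof (cases "l \<le> k")
        case True
        then have "(\<Sum>s\<in>{a..<l}. X s \<omega>) + (\<Sum>s\<in>{l..<k}. X s \<omega>) = (\<Sum>s\<in>{a..<k}. X s \<omega>)"
          using that by (intro sum.atLeastLessThan_concat) auto
        moreover have "\<bar>\<Sum>s\<in>{a..<l}. X s \<omega>\<bar> < e / 2" "\<bar>\<Sum>s\<in>{a..<k}. X s \<omega>\<bar> < e / 2"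
          using a n that True by (meson order.strict_trans order.trans)+
        ultimately show ?thesis unfolding real_norm_def by linarith
      qed (use \<open>0 < e\<close> in auto)
      then show "\<exists>N. \<forall>m\<ge>N. \<forall>n. norm (\<Sum>s\<in>{m..<n}. X s \<omega>) < e" by blast
    qed
  qed
qed

end

section \<open>Quadratic forms and perturbed linear recursions\<close>

text \<open>A matrix is a vector of rows, so its \<open>norm\<close> is the Frobenius norm, and
  Cauchy-Schwarz applies in each row.\<close>

lemma norm_matrix_vector_mult_le: "norm (A *v x) \<le> norm A * norm (x :: real^'c)" for A :: "real^'c^'r"
proof -
  have "norm (A *v x) \<le> L2_set (\<lambda>i. norm (A $ i) * norm x) UNIV"
    unfolding norm_vec_def[of "A *v x"]
    by (intro L2_set_mono) (auto simp: matrix_vector_mul_component Cauchy_Schwarz_ineq2)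
  also have "\<dots> = norm A * norm x"
    unfolding norm_vec_def[of A] by (simp add: L2_set_left_distrib)
  finally show ?thesis .
qed

text \<open>A \<open>Min\<close> over eigenvalues is informative only if their set is finite and
  contains the minimum of the form on the unit sphere. Compactness gives a minimiser, which turns
  out to be an eigenvector; orthogonality of eigenvectors for distinct eigenvalues gives
  finiteness.\<close>

lemma quadratic_form_ge_lambda_min:
  fixes S :: "real^'k^'k"
  assumes sym: "transpose S = S"
  shows "lambda_min S * (norm x)\<^sup>2 \<le> x \<bullet> (S *v x)"
proof -
  have symm: "y \<bullet> (S *v w) = w \<bullet> (S *v y)" for y w
    by (metis dot_lmul_matrix inner_commute sym transpose_matrix_vector)
  obtain v where v: "norm v = 1" and min: "\<And>y. norm y = 1 \<Longrightarrow> v \<bullet> (S *v v) \<le> y \<bullet> (S *v y)"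
  proof -
    have "\<exists>v\<in>sphere 0 1. \<forall>y\<in>sphere 0 1. v \<bullet> (S *v v) \<le> y \<bullet> (S *v y)"
      by (rule continuous_attains_inf)
         (auto intro!: continuous_on_inner continuous_on_id matrix_vector_mult_linear_continuous_on)
    then show ?thesis using that by auto
  qed
  define \<mu> where "\<mu> = v \<bullet> (S *v v)"
  have ge: "\<mu> * (norm y)\<^sup>2 \<le> y \<bullet> (S *v y)" for y
  proof (cases "y = 0")
    case False
    then have "\<mu> \<le> (y /\<^sub>R norm y) \<bullet> (S *v (y /\<^sub>R norm y))"
      unfolding \<mu>_def by (intro min) simp
    also have "\<dots> = (y \<bullet> (S *v y)) / (norm y)\<^sup>2"
      by (simp add: matrix_vector_mult_scaleR power2_eq_square divide_simps)
    finally show ?thesis using False by (simp add: field_simps)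
  qed simp
  \<comment> \<open>First-order optimality: moving from \<open>v\<close> to \<open>v - s d\<close>
    changes the gap between the form and \<open>\<mu>\<close> times the squared norm from zero to
    \<open>s\<^sup>2 g - 2 s (d \<bullet> d)\<close>. It must stay nonnegative for every positive
    \<open>s\<close>, which a small \<open>s\<close> refutes unless the residual \<open>d\<close> is
    zero.\<close>
  define d where "d = S *v v - \<mu> *\<^sub>R v"
  have "S *v v = \<mu> *\<^sub>R v"
  proof (rule ccontr)
    assume "S *v v \<noteq> \<mu> *\<^sub>R v"
    then have d: "0 < d \<bullet> d" by (simp add: d_def)
    define g where "g = d \<bullet> (S *v d) - \<mu> * (d \<bullet> d)"
    have dd: "d \<bullet> (S *v v) - \<mu> * (d \<bullet> v) = d \<bullet> d"
      by (simp add: d_def inner_diff_left inner_diff_right)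
    have *: "2 * (d \<bullet> d) \<le> s * g" if "0 < s" for s
    proof -
      have "\<mu> * ((v - s *\<^sub>R d) \<bullet> (v - s *\<^sub>R d)) \<le> (v - s *\<^sub>R d) \<bullet> (S *v (v - s *\<^sub>R d))"
        using ge[of "v - s *\<^sub>R d"] by (simp add: power2_norm_eq_inner)
      moreover have "v \<bullet> v = 1" using v by (simp add: norm_eq_1)
      ultimately have "0 \<le> s * (s * g - 2 * (d \<bullet> (S *v v) - \<mu> * (d \<bullet> v)))"
        by (simp add: g_def \<mu>_def[symmetric] algebra_simps inner_diff_left inner_diff_right
            matrix_vector_mult_diff_distrib matrix_vector_mult_scaleR symm[of v d] inner_commute[of v d])
      then show ?thesis using that unfolding dd by (simp add: zero_le_mult_iff)
    qed
    from *[of 1] d have g: "0 < g" by linarith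
    from *[of "(d \<bullet> d) / g"] g d show False by (simp add: field_simps)
  qed
  then have \<mu>: "\<mu> \<in> {c. \<exists>v. v \<noteq> 0 \<and> S *v v = c *\<^sub>R v}"
    using v by (auto intro!: exI[of _ v])
  define w where "w c = (SOME v. v \<noteq> 0 \<and> S *v v = c *\<^sub>R v)" for c
  let ?E = "{c. \<exists>v. v \<noteq> 0 \<and> S *v v = c *\<^sub>R v}"
  have w: "w c \<noteq> 0" "S *v w c = c *\<^sub>R w c" if "c \<in> ?E" for c
    using someI_ex[of "\<lambda>v. v \<noteq> 0 \<and> S *v v = c *\<^sub>R v"] that unfolding w_def by auto
  have orth: "orthogonal (w c) (w c')" if "c \<in> ?E" "c' \<in> ?E" "c \<noteq> c'" for c c'
  proof -
    have "c' * (w c \<bullet> w c') = c * (w c \<bullet> w c')"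
      using symm[of "w c" "w c'"] w that by (simp add: inner_commute)
    then show ?thesis using that by (simp add: orthogonal_def)
  qed
  have inj: "inj_on w ?E"
  proof (rule inj_onI, rule ccontr)
    fix c c' assume cc: "c \<in> ?E" "c' \<in> ?E" "w c = w c'" "c \<noteq> c'"
    have "orthogonal (w c) (w c')" using orth cc(1,2,4) .
    then show False using w(1)[OF cc(2)] cc(3) by (simp add: orthogonal_self)
  qed
  have "pairwise orthogonal (w ` ?E)" using orth by (auto simp: pairwise_def)
  then have "finite (w ` ?E)" by (rule pairwise_orthogonal_imp_finite)
  then have "finite ?E" using inj by (simp add: finite_image_iff)
  then have "lambda_min S \<le> \<mu>" unfolding lambda_min_def using \<mu> by (rule Min_le)
  then have "lambda_min S * (norm x)\<^sup>2 \<le> \<mu> * (norm x)\<^sup>2" by (intro mult_right_mono) auto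
  with ge[of x] show ?thesis by linarith
qed

text \<open>Once \<open>\<epsilon> t < c * \<eta>\<close>, the inhomogeneity is absorbed by the
  level \<open>\<eta>\<close>, and the excess of \<open>v\<close> over \<open>\<eta>\<close> shrinks
  by the factor \<open>exp (- c * al t)\<close>. Divergence of the sum of \<open>al\<close> makes
  the product of these factors vanish.\<close>

lemma recursion_tendsto_zero:
  fixes v \<epsilon> al :: "nat \<Rightarrow> real"
  assumes v: "\<And>t. 0 \<le> v t" and c: "0 < c"
    and al: "\<And>t. 0 < al t" "al \<longlonglongrightarrow> 0" "\<not> summable al"
    and \<epsilon>: "\<epsilon> \<longlonglongrightarrow> 0"
    and step: "\<forall>\<^sub>F t in sequentially. v (Suc t) \<le> (1 - c * al t) * v t + \<epsilon> t * al t"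
  shows "v \<longlonglongrightarrow> 0"
proof (rule tendstoI)
  fix e :: real assume "0 < e"
  define \<eta> where "\<eta> = e / 2"
  have \<eta>: "0 < \<eta>" using \<open>0 < e\<close> by (simp add: \<eta>_def)
  have "\<forall>\<^sub>F t in sequentially. \<epsilon> t < c * \<eta>"
    using \<epsilon> c \<eta> by (intro order_tendstoD(2)) auto
  moreover have "\<forall>\<^sub>F t in sequentially. al t < 1 / c"
    using al(2) c by (intro order_tendstoD(2)) auto
  ultimately have "\<forall>\<^sub>F t in sequentially. \<epsilon> t < c * \<eta> \<and> al t < 1 / c \<and>
      v (Suc t) \<le> (1 - c * al t) * v t + \<epsilon> t * al t"
    using step by eventually_elim simp
  then obtain t0 where t0: "\<And>t. t0 \<le> t \<Longrightarrow> \<epsilon> t < c * \<eta> \<and> al t < 1 / c \<and>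
      v (Suc t) \<le> (1 - c * al t) * v t + \<epsilon> t * al t"
    unfolding eventually_sequentially by blast
  define p where "p t = max (v t - \<eta>) 0" for t
  have p_step: "p (Suc t) \<le> exp (- c * al t) * p t" if "t0 \<le> t" for t
  proof -
    have "\<epsilon> t * al t \<le> c * \<eta> * al t" using t0[OF that] al(1)[of t] by (intro mult_right_mono) auto
    then have "v (Suc t) - \<eta> \<le> (1 - c * al t) * (v t - \<eta>)"
      using t0[OF that] by (simp add: algebra_simps)
    also have "\<dots> \<le> (1 - c * al t) * p t"
      using t0[OF that] c by (intro mult_left_mono) (auto simp: p_def field_simps)
    also have "\<dots> \<le> exp (- c * al t) * p t"
      using exp_ge_add_one_self[of "- c * al t"] by (intro mult_right_mono) (auto simp: p_def)
    finally show ?thesis by (simp add: p_def)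
  qed
  have p_bound: "p (t0 + n) \<le> exp (- c * (\<Sum>s<n. al (s + t0))) * p t0" for n
  proof (induction n)
    case (Suc n)
    have "p (t0 + Suc n) \<le> exp (- c * al (t0 + n)) * p (t0 + n)" using p_step[of "t0 + n"] by simp
    also have "\<dots> \<le> exp (- c * al (t0 + n)) * (exp (- c * (\<Sum>s<n. al (s + t0))) * p t0)"
      using Suc by (intro mult_left_mono) auto
    also have "\<dots> = exp (- c * (\<Sum>s<Suc n. al (s + t0))) * p t0"
      by (simp add: mult_exp_exp[symmetric] exp_add[symmetric] algebra_simps)
    finally show ?case .
  qed simp
  have "filterlim (\<lambda>n. \<Sum>s<n. al (s + t0)) at_top sequentially"
    unfolding filterlim_at_top
  proof
    fix Z
    have "\<not> summable (\<lambda>s. al (s + t0))" using al(3) by (simp add: summable_iff_shift)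
    then obtain n where n: "Z < (\<Sum>s<n. al (s + t0))"
      using summableI_nonneg_bounded[of "\<lambda>s. al (s + t0)" Z] al(1) less_imp_le not_le by metis
    have "Z \<le> (\<Sum>s<k. al (s + t0))" if "n \<le> k" for k
    proof -
      have "(\<Sum>s<n. al (s + t0)) \<le> (\<Sum>s<k. al (s + t0))"
        using that al(1) by (intro sum_mono2) (auto intro: less_imp_le)
      then show ?thesis using n by simp
    qed
    then show "\<forall>\<^sub>F n in sequentially. Z \<le> (\<Sum>s<n. al (s + t0))"
      unfolding eventually_sequentially by blast
  qed
  then have "filterlim (\<lambda>n. - c * (\<Sum>s<n. al (s + t0))) at_bot sequentially"
    using c by (intro filterlim_tendsto_neg_mult_at_bot[OF tendsto_const]) auto
  then have "(\<lambda>n. exp (- c * (\<Sum>s<n. al (s + t0)))) \<longlonglongrightarrow> 0"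
    by (rule filterlim_compose[OF exp_at_bot])
  then have "(\<lambda>n. exp (- c * (\<Sum>s<n. al (s + t0))) * p t0) \<longlonglongrightarrow> 0"
    by (rule tendsto_mult_left_zero)
  then have "\<forall>\<^sub>F n in sequentially. exp (- c * (\<Sum>s<n. al (s + t0))) * p t0 < \<eta>"
    using \<eta> by (intro order_tendstoD(2)) auto
  then have "\<forall>\<^sub>F n in sequentially. dist (v (n + t0)) 0 < e"
  proof eventually_elim
    case (elim n)
    then have "p (t0 + n) < \<eta>" using p_bound[of n] by linarith
    then have "v (t0 + n) - \<eta> < \<eta>" unfolding p_def by simp
    then show ?case using v[of "t0 + n"] by (simp add: \<eta>_def add.commute)
  qed
  then show "\<forall>\<^sub>F n in sequentially. dist (v n) 0 < e"
    by (subst (asm) eventually_sequentially_seg)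
qed

section \<open>Correctors from tails of convergent series\<close>

lemma summable_tails:
  fixes f :: "nat \<Rightarrow> 'b::banach"
  assumes "summable f"
  obtains N where "N \<longlonglongrightarrow> 0" "\<And>t. N t = f t + N (Suc t)"
proof
  show "(\<lambda>t. \<Sum>s. f (s + t)) \<longlonglongrightarrow> 0" using assms by (rule suminf_exist_split2)
  show "(\<Sum>s. f (s + t)) = f t + (\<Sum>s. f (s + Suc t))" for t
    using suminf_split_head[of "\<lambda>s. f (s + t)"] summable_ignore_initial_segment[OF assms, of t] by simp
qed

text \<open>Adding the tail \<open>N\<close> of the convergent noise series removes the noise; multiplying by \<open>I - T\<close>, with \<open>T\<close> the
  tail of \<open>\<Sum> al t (B t - \<Lambda> t)\<close>, replaces the random matrices \<open>B\<close> by the coercive \<open>\<Lambda>\<close>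
  up to terms of size \<open>o(al t)\<close>.\<close>

lemma perturbed_recursion_tendsto_zero:
  fixes z n r :: "nat \<Rightarrow> real^'k" and B \<Lambda> :: "nat \<Rightarrow> real^'k^'k"
  assumes al: "\<And>t. 0 < al t" "al \<longlonglongrightarrow> 0" "\<not> summable al"
    and z_step: "\<And>t. z (Suc t) = z t - al t *\<^sub>R (B t *v z t) + n t + r t"
    and n: "summable n"
    and r: "\<And>t. norm (r t) \<le> \<epsilon> t * al t * (1 + norm (z t))" and \<epsilon>: "\<epsilon> \<longlonglongrightarrow> 0"
    and B: "\<And>t. norm (B t) \<le> K" and \<Lambda>: "\<And>t. norm (\<Lambda> t) \<le> K"
    and diff: "summable (\<lambda>t. al t *\<^sub>R (B t - \<Lambda> t))"
    and \<mu>: "0 < \<mu>" "\<And>t y. \<mu> * (norm y)\<^sup>2 \<le> y \<bullet> (\<Lambda> t *v y)"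
  shows "z \<longlonglongrightarrow> 0"
proof -
  obtain N where N: "N \<longlonglongrightarrow> 0" "\<And>t. N t = n t + N (Suc t)" using summable_tails[OF n] by blast
  obtain T where T: "T \<longlonglongrightarrow> 0" "\<And>t. T t = al t *\<^sub>R (B t - \<Lambda> t) + T (Suc t)"
    using summable_tails[OF diff] by blast
  have K: "0 \<le> K" using B[of 0] norm_ge_zero order_trans by blast
  have \<epsilon>0: "0 \<le> \<epsilon> t" for t
  proof -
    have "0 \<le> \<epsilon> t * (al t * (1 + norm (z t)))" using order_trans[OF norm_ge_zero r[of t]] by (simp add: ac_simps)
    moreover have "0 < al t * (1 + norm (z t))" using al(1) by (simp add: add_pos_nonneg)
    ultimately show ?thesis by (simp add: zero_le_mult_iff)
  qed
  have mv: "norm (A *v y) \<le> a * b" if "norm A \<le> a" "norm y \<le> b" for A :: "real^'k^'k" and y a b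
    by (rule order_trans[OF norm_matrix_vector_mult_le])
       (use that in \<open>auto intro!: mult_mono intro: order_trans[OF norm_ge_zero]\<close>)

  \<comment> \<open>Since \<open>n t + N (Suc t) = N t\<close>, adding the tail cancels the noise
    exactly. What remains is \<open>al t\<close> times the action of \<open>B t\<close> on
    \<open>N t\<close>, and \<open>N\<close> tends to zero.\<close>
  define u where "u t = z t + N t" for t
  define r1 where "r1 t = al t *\<^sub>R (B t *v N t) + r t" for t
  define \<epsilon>1 where "\<epsilon>1 t = K * norm (N t) + \<epsilon> t * (1 + norm (N t))" for t
  have \<epsilon>1: "\<epsilon>1 \<longlonglongrightarrow> 0" "\<And>t. 0 \<le> \<epsilon>1 t"
  proof -
    have "\<epsilon>1 \<longlonglongrightarrow> K * 0 + 0 * (1 + 0)"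
      unfolding \<epsilon>1_def by (intro tendsto_intros tendsto_norm_zero N(1) \<epsilon>)
    then show "\<epsilon>1 \<longlonglongrightarrow> 0" by simp
    show "0 \<le> \<epsilon>1 t" for t using K \<epsilon>0[of t] by (auto simp: \<epsilon>1_def)
  qed
  have u_step: "u (Suc t) = u t - al t *\<^sub>R (B t *v u t) + r1 t" for t
    using z_step[of t] N(2)[of t] by (simp add: u_def r1_def algebra_simps matrix_vector_right_distrib)
  have r1: "norm (r1 t) \<le> \<epsilon>1 t * al t * (1 + norm (u t))" for t
  proof -
    have "norm (z t) \<le> norm (u t) + norm (N t)"
      using norm_triangle_ineq4[of "u t" "N t"] by (simp add: u_def)
    moreover have "0 \<le> norm (N t) * norm (u t)" by simp
    ultimately have "1 + norm (z t) \<le> (1 + norm (N t)) * (1 + norm (u t))"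
      unfolding distrib_left distrib_right by linarith
    then have "\<epsilon> t * al t * (1 + norm (z t)) \<le> \<epsilon> t * al t * ((1 + norm (N t)) * (1 + norm (u t)))"
      using \<epsilon>0[of t] al(1)[of t] by (intro mult_left_mono) auto
    moreover have "norm (al t *\<^sub>R (B t *v N t)) \<le> al t * (K * norm (N t)) * (1 + norm (u t))"
    proof -
      have "norm (al t *\<^sub>R (B t *v N t)) \<le> al t * (K * norm (N t))"
        using mv[OF B order.refl, of t "N t"] al(1)[of t] by simp
      also have "\<dots> \<le> al t * (K * norm (N t)) * (1 + norm (u t))"
        using al(1)[of t] K by (simp add: distrib_left)
      finally show ?thesis .
    qed
    moreover have "norm (r1 t) \<le> norm (al t *\<^sub>R (B t *v N t)) + norm (r t)"
      unfolding r1_def by (rule norm_triangle_ineq)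
    moreover note r[of t]
    moreover have "\<epsilon>1 t * al t * (1 + norm (u t)) =
        al t * (K * norm (N t)) * (1 + norm (u t)) + \<epsilon> t * al t * ((1 + norm (N t)) * (1 + norm (u t)))"
      by (simp add: \<epsilon>1_def algebra_simps)
    ultimately show ?thesis by linarith
  qed

  \<comment> \<open>Passing from \<open>T t\<close> to \<open>T (Suc t)\<close> contributes
    \<open>al t\<close> times \<open>(B t - \<Lambda> t) *v u t\<close>, which turns
    \<open>B\<close> into \<open>\<Lambda>\<close> in the leading term. As \<open>d t\<close> is of
    order \<open>al t\<close>, the leftovers in \<open>r2\<close> gain a further small factor:
    \<open>T t\<close> in two of them, a second \<open>al t\<close> in another, and
    \<open>\<epsilon>1 t\<close> in \<open>r1\<close>.\<close>
  define w where "w t = u t - T t *v u t" for t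
  define d where "d t = r1 t - al t *\<^sub>R (B t *v u t)" for t
  define r2 where "r2 t = r1 t - T t *v d t + al t *\<^sub>R ((B t - \<Lambda> t) *v d t) - al t *\<^sub>R (\<Lambda> t *v (T t *v u t))" for t
  have w_step: "w (Suc t) = w t - al t *\<^sub>R (\<Lambda> t *v w t) + r2 t" for t
  proof -
    have T': "T (Suc t) = T t - al t *\<^sub>R (B t - \<Lambda> t)" using T(2)[of t] by simp
    have u': "u (Suc t) = u t + d t" by (simp add: u_step d_def)
    show ?thesis
      unfolding w_def T' u' r2_def
      by (simp add: matrix_vector_right_distrib matrix_vector_mult_diff_rdistrib matrix_vector_mult_diff_distrib
          scaleR_matrix_vector_assoc[symmetric] algebra_simps)
         (simp add: d_def algebra_simps)
  qed
  \<comment> \<open>The four summands bound the four pieces of \<open>r2\<close>, divided by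
    \<open>al t * (1 + norm (u t))\<close>.\<close>
  define \<epsilon>2 where "\<epsilon>2 t = \<epsilon>1 t + norm (T t) * (K + \<epsilon>1 t) + al t * (2 * K * (K + \<epsilon>1 t)) + K * norm (T t)" for t
  have \<epsilon>2: "\<epsilon>2 \<longlonglongrightarrow> 0"
  proof -
    have "\<epsilon>2 \<longlonglongrightarrow> 0 + 0 * (K + 0) + 0 * (2 * K * (K + 0)) + K * 0"
      unfolding \<epsilon>2_def by (intro tendsto_intros tendsto_norm_zero T(1) \<epsilon>1 al)
    then show ?thesis by simp
  qed
  have \<epsilon>2_nonneg: "0 \<le> \<epsilon>2 t" for t
    using \<epsilon>1(2)[of t] al(1)[of t] K by (simp add: \<epsilon>2_def less_imp_le)
  have r2: "norm (r2 t) \<le> \<epsilon>2 t * al t * (1 + norm (u t))" for t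
  proof -
    let ?U = "al t * (1 + norm (u t))"
    have d: "norm (d t) \<le> (K + \<epsilon>1 t) * ?U"
    proof -
      have "norm (al t *\<^sub>R (B t *v u t)) \<le> K * ?U"
        using mv[OF B order.refl, of t "u t"] al(1)[of t] K
        by (simp add: algebra_simps add_increasing)
      moreover have "norm (d t) \<le> norm (r1 t) + norm (al t *\<^sub>R (B t *v u t))"
        unfolding d_def by (rule norm_triangle_ineq4)
      ultimately show ?thesis using r1[of t] by (simp add: algebra_simps)
    qed
    have a: "norm (T t *v d t) \<le> norm (T t) * ((K + \<epsilon>1 t) * ?U)" by (rule mv[OF order.refl d])
    have "norm (B t - \<Lambda> t) \<le> 2 * K" using norm_triangle_ineq4[of "B t" "\<Lambda> t"] B[of t] \<Lambda>[of t] by linarith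
    then have "norm ((B t - \<Lambda> t) *v d t) \<le> 2 * K * ((K + \<epsilon>1 t) * ?U)" by (rule mv[OF _ d])
    then have b: "norm (al t *\<^sub>R ((B t - \<Lambda> t) *v d t)) \<le> al t * (2 * K * ((K + \<epsilon>1 t) * ?U))"
      using al(1)[of t] by simp
    have "norm (\<Lambda> t *v (T t *v u t)) \<le> K * (norm (T t) * norm (u t))"
      by (rule mv[OF \<Lambda> mv]) auto
    also have "\<dots> \<le> K * (norm (T t) * (1 + norm (u t)))"
      using K by (intro mult_left_mono) auto
    finally have c: "norm (al t *\<^sub>R (\<Lambda> t *v (T t *v u t))) \<le> al t * (K * (norm (T t) * (1 + norm (u t))))"
      using al(1)[of t] by simp
    have "norm (r2 t) \<le> norm (r1 t) + norm (T t *v d t) + norm (al t *\<^sub>R ((B t - \<Lambda> t) *v d t))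
        + norm (al t *\<^sub>R (\<Lambda> t *v (T t *v u t)))"
      unfolding r2_def by (intro order_trans[OF norm_triangle_ineq4] order_trans[OF norm_triangle_ineq] add_mono order.refl)
    also have "\<dots> \<le> \<epsilon>1 t * al t * (1 + norm (u t)) + norm (T t) * ((K + \<epsilon>1 t) * ?U)
        + al t * (2 * K * ((K + \<epsilon>1 t) * ?U)) + al t * (K * (norm (T t) * (1 + norm (u t))))"
      by (intro add_mono r1 a b c)
    also have "\<dots> = \<epsilon>2 t * al t * (1 + norm (u t))"
      by (simp add: \<epsilon>2_def algebra_simps)
    finally show ?thesis .
  qed

  \<comment> \<open>From here on \<open>I - T t\<close> is boundedly invertible, so remainder bounds
    in \<open>u\<close> become bounds in \<open>w\<close>, and convergence of \<open>w\<close>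
    carries back to \<open>u\<close>.\<close>
  have T_half: "\<forall>\<^sub>F t in sequentially. norm (T t) < 1 / 2"
    using tendsto_norm_zero[OF T(1)] by (rule order_tendstoD(2)) simp
  have u_le: "\<forall>\<^sub>F t in sequentially. norm (u t) \<le> 2 * norm (w t)"
    using T_half
  proof eventually_elim
    case (elim t)
    have "norm (T t *v u t) \<le> 1 / 2 * norm (u t)" using elim by (intro mv) auto
    moreover have "norm (u t) \<le> norm (w t) + norm (T t *v u t)"
      using norm_triangle_ineq[of "w t" "T t *v u t"] by (simp add: w_def)
    ultimately show ?case by linarith
  qed
  \<comment> \<open>The first threshold makes the quadratic term at most
    \<open>al t * \<mu>\<close>, leaving \<open>1 - al t * \<mu>\<close>, which is below
    \<open>(1 - \<mu> / 2 * al t)\<^sup>2\<close>; the \<open>+ 1\<close> covers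
    \<open>K = 0\<close>. The second keeps the root nonnegative, so that squares can be removed. The
    third gives \<open>2 * \<epsilon>2 t \<le> \<mu> / 4\<close> and so spends half of the rate
    \<open>\<mu> / 2\<close>.\<close>
  have "\<forall>\<^sub>F t in sequentially. al t < \<mu> / (K\<^sup>2 + 1)"
    using al(2) by (rule order_tendstoD(2)) (use \<mu> in \<open>simp add: add_nonneg_pos\<close>)
  moreover have "\<forall>\<^sub>F t in sequentially. al t < 1 / \<mu>"
    using al(2) by (rule order_tendstoD(2)) (use \<mu> in simp)
  moreover have "\<forall>\<^sub>F t in sequentially. \<epsilon>2 t < \<mu> / 8"
    using \<epsilon>2 by (rule order_tendstoD(2)) (use \<mu> in simp)
  ultimately have "\<forall>\<^sub>F t in sequentially. norm (w (Suc t)) \<le> (1 - \<mu> / 4 * al t) * norm (w t) + (2 * \<bar>\<epsilon>2 t\<bar>) * al t"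
    using u_le
  proof eventually_elim
    case (elim t)
    have "al t * (K\<^sup>2 + 1) \<le> \<mu>" using elim(1) by (simp add: pos_less_divide_eq add_nonneg_pos)
    then have alK: "al t * K\<^sup>2 \<le> \<mu>" using al(1)[of t] by (simp add: algebra_simps)
    have "(norm (w t - al t *\<^sub>R (\<Lambda> t *v w t)))\<^sup>2 =
        (norm (w t))\<^sup>2 - 2 * al t * (w t \<bullet> (\<Lambda> t *v w t)) + (al t)\<^sup>2 * (norm (\<Lambda> t *v w t))\<^sup>2"
      unfolding power2_norm_eq_inner
      by (simp add: inner_diff_left inner_diff_right inner_commute[of "\<Lambda> t *v w t" "w t"] power2_eq_square algebra_simps)
    also have "\<dots> \<le> (norm (w t))\<^sup>2 - 2 * al t * (\<mu> * (norm (w t))\<^sup>2) + (al t)\<^sup>2 * (K * norm (w t))\<^sup>2"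
      using al(1)[of t] \<mu>(2)[of "w t" t] mv[OF \<Lambda> order.refl, of t "w t"]
      by (intro add_mono diff_mono mult_left_mono power_mono) auto
    also have "\<dots> = (1 - 2 * al t * \<mu> + al t * (al t * K\<^sup>2)) * (norm (w t))\<^sup>2"
      by (simp add: power2_eq_square algebra_simps)
    also have "\<dots> \<le> (1 - 2 * al t * \<mu> + al t * \<mu>) * (norm (w t))\<^sup>2"
      using al(1)[of t] alK by (intro mult_right_mono add_left_mono mult_left_mono) auto
    also have "\<dots> \<le> (1 - \<mu> / 2 * al t)\<^sup>2 * (norm (w t))\<^sup>2"
      using \<mu>(1) al(1)[of t] by (intro mult_right_mono) (simp_all add: power2_eq_square algebra_simps less_imp_le)
    finally have "(norm (w t - al t *\<^sub>R (\<Lambda> t *v w t)))\<^sup>2 \<le> ((1 - \<mu> / 2 * al t) * norm (w t))\<^sup>2"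
      by (simp add: power_mult_distrib)
    moreover have "0 \<le> (1 - \<mu> / 2 * al t) * norm (w t)"
      using elim(2) \<mu>(1) by (intro mult_nonneg_nonneg) (simp_all add: field_simps)
    ultimately have 1: "norm (w t - al t *\<^sub>R (\<Lambda> t *v w t)) \<le> (1 - \<mu> / 2 * al t) * norm (w t)"
      by (rule power2_le_imp_le)
    have "\<epsilon>2 t * al t * (1 + norm (u t)) \<le> \<bar>\<epsilon>2 t\<bar> * al t * (2 * (1 + norm (w t)))"
      using elim(4) al(1)[of t] by (intro mult_mono) auto
    then have 2: "norm (r2 t) \<le> 2 * \<bar>\<epsilon>2 t\<bar> * al t + (2 * \<epsilon>2 t) * (al t * norm (w t))"
    proof -
      have "\<bar>\<epsilon>2 t\<bar> * al t * (2 * (1 + norm (w t))) = 2 * \<bar>\<epsilon>2 t\<bar> * al t + (2 * \<epsilon>2 t) * (al t * norm (w t))"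
        using \<epsilon>2_nonneg[of t] by (simp add: distrib_left)
      with r2[of t] \<open>\<epsilon>2 t * al t * (1 + norm (u t)) \<le> \<bar>\<epsilon>2 t\<bar> * al t * (2 * (1 + norm (w t)))\<close>
      show ?thesis by linarith
    qed
    have "(2 * \<epsilon>2 t) * (al t * norm (w t)) \<le> \<mu> / 4 * (al t * norm (w t))"
      using elim(3) al(1)[of t] by (intro mult_right_mono) auto
    moreover have "norm (w (Suc t)) \<le> norm (w t - al t *\<^sub>R (\<Lambda> t *v w t)) + norm (r2 t)"
      unfolding w_step by (rule norm_triangle_ineq)
    ultimately show ?case using 1 2 by (simp add: algebra_simps)
  qed
  moreover have "(\<lambda>t. 2 * \<bar>\<epsilon>2 t\<bar>) \<longlonglongrightarrow> 0" by (intro tendsto_mult_right_zero tendsto_rabs_zero \<epsilon>2)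
  moreover have "0 < \<mu> / 4" using \<mu>(1) by simp
  ultimately have "(\<lambda>t. norm (w t)) \<longlonglongrightarrow> 0"
    using recursion_tendsto_zero[OF norm_ge_zero _ al] by blast
  then have "(\<lambda>t. 2 * norm (w t)) \<longlonglongrightarrow> 0" by (rule tendsto_mult_right_zero)
  then have "u \<longlonglongrightarrow> 0" by (rule Lim_null_comparison[OF u_le])
  then have "(\<lambda>t. u t - N t) \<longlonglongrightarrow> 0 - 0" using N(1) by (rule tendsto_diff)
  then show ?thesis by (simp add: u_def)
qed

text \<open>Within a block \<open>al\<close> varies only by \<open>O((al t)\<^sup>2)\<close>, because the increments of \<open>1 / al\<close> are bounded.\<close>

lemma summable_of_block_sums:
  fixes al G :: "nat \<Rightarrow> real"
  assumes al: "\<And>t. 0 < al t" "al \<longlonglongrightarrow> 0" "summable (\<lambda>t. (al t)\<^sup>2)"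
    and c: "\<And>t. \<bar>1 / al (Suc t) - 1 / al t\<bar> \<le> c"
    and G: "\<And>t. \<bar>G t\<bar> \<le> K" and h: "0 < h"
    and block: "summable (\<lambda>m. al (m * h) * (\<Sum>t\<in>{m*h..<m*h+h}. G t))"
  shows "summable (\<lambda>t. al t * G t)"
proof -
  have K: "0 \<le> K" using G[of 0] abs_ge_zero order_trans by blast
  have c0: "0 \<le> c" using c[of 0] abs_ge_zero order_trans by blast
  define b where "b t = t div h * h" for t
  obtain A where A: "\<And>t. al t \<le> A"
  proof -
    have "Bseq al" using al(2) by (intro convergent_imp_Bseq) (auto simp: convergent_def)
    then show ?thesis using that by (auto simp: Bseq_def abs_le_iff)
  qed
  have inv: "\<bar>1 / al (s + j) - 1 / al s\<bar> \<le> real j * c" for s j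
  proof (induction j)
    case (Suc j)
    then show ?case using c[of "s + j"] by (simp add: algebra_simps)
  qed simp
  define C where "C = real h * c"
  have C: "0 \<le> C" using c0 by (simp add: C_def)
  have invb: "\<bar>1 / al t - 1 / al (b t)\<bar> \<le> C" for t
  proof -
    have "\<bar>1 / al t - 1 / al (b t)\<bar> \<le> real (t mod h) * c"
      using inv[of "b t" "t mod h"] by (simp add: b_def)
    also have "\<dots> \<le> C" unfolding C_def using h c0 by (intro mult_right_mono) auto
    finally show ?thesis .
  qed
  have close: "\<bar>al t - al (b t)\<bar> \<le> C * (1 + C * A) * (al t)\<^sup>2" for t
  proof -
    have pos: "0 < al t" "0 < al (b t)" by (rule al(1))+
    have e: "\<bar>al t - al (b t)\<bar> = al t * al (b t) * \<bar>1 / al t - 1 / al (b t)\<bar>"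
    proof -
      have "al t - al (b t) = - (al t * al (b t) * (1 / al t - 1 / al (b t)))"
        using pos by (simp add: field_simps)
      then show ?thesis using pos by (simp add: abs_mult)
    qed
    have le: "\<bar>al t - al (b t)\<bar> \<le> al t * al (b t) * C"
      unfolding e using invb[of t] pos by (intro mult_left_mono) auto
    \<comment> \<open>The crude bound \<open>A\<close> first yields that \<open>al (b t)\<close> is
      at most a multiple of \<open>al t\<close>; inserting this again gives the square of
      \<open>al t\<close>, which is summable.\<close>
    have "al t * al (b t) * C \<le> al t * A * C" using pos A[of "b t"] C by (intro mult_mono) auto
    then have "al (b t) \<le> al t * (1 + C * A)" using le by (simp add: algebra_simps)
    then have "al t * al (b t) * C \<le> al t * (al t * (1 + C * A)) * C"
      using pos C by (intro mult_mono) auto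
    then show ?thesis using le by (simp add: power2_eq_square algebra_simps)
  qed
  have s1: "summable (\<lambda>t. (al t - al (b t)) * G t)"
  proof (rule summable_comparison_test')
    show "summable (\<lambda>t. C * (1 + C * A) * (al t)\<^sup>2 * K)" using al(3) by (intro summable_mult summable_mult2)
    show "norm ((al t - al (b t)) * G t) \<le> C * (1 + C * A) * (al t)\<^sup>2 * K" for t
      unfolding real_norm_def abs_mult
      using close[of t] G[of t] by (intro mult_mono) (use order_trans[OF abs_ge_zero close[of t]] in auto)
  qed
  \<comment> \<open>With the step size frozen at the block start, partial sums up to a multiple of
    \<open>h\<close> are exactly those of the block series. The incomplete last block has fewer than
    \<open>h\<close> terms, each at most \<open>al (b t) * K\<close>, and vanishes in the
    limit.\<close>
  define q where "q t = al (b t) * G t" for t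
  define R where "R m = (\<Sum>k<m. al (k * h) * (\<Sum>t\<in>{k*h..<k*h+h}. G t))" for m
  have R: "sum q {..<m * h} = R m" for m
  proof -
    have "sum q {k*h..<k*h+h} = al (k * h) * (\<Sum>t\<in>{k*h..<k*h+h}. G t)" for k
    proof -
      have "b t = k * h" if "t \<in> {k*h..<k*h+h}" for t
      proof -
        have "t div h = k" using that by (intro div_nat_eqI) (auto simp: algebra_simps)
        then show ?thesis by (simp add: b_def)
      qed
      then show ?thesis by (simp add: q_def sum_distrib_left)
    qed
    then show ?thesis unfolding R_def by (simp add: sum.nat_group[symmetric])
  qed
  have dv: "filterlim (\<lambda>t. t div h) at_top sequentially"
    using h by (intro filterlim_at_top_div_const_nat)
  have "(\<lambda>t. R (t div h)) \<longlonglongrightarrow> suminf (\<lambda>m. al (m * h) * (\<Sum>t\<in>{m*h..<m*h+h}. G t))"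
    unfolding R_def by (rule filterlim_compose[OF summable_LIMSEQ[OF block] dv])
  moreover have "(\<lambda>t. sum q {b t..<t}) \<longlonglongrightarrow> 0"
  proof (rule Lim_null_comparison)
    have "filterlim b at_top sequentially"
      by (rule filterlim_at_top_mono[OF dv]) (use h in \<open>auto simp: b_def\<close>)
    then have "(\<lambda>t. al (b t)) \<longlonglongrightarrow> 0" by (rule filterlim_compose[OF al(2)])
    then show "(\<lambda>t. real h * (al (b t) * K)) \<longlonglongrightarrow> 0" by (intro tendsto_mult_right_zero tendsto_mult_left_zero)
    show "\<forall>\<^sub>F t in sequentially. norm (sum q {b t..<t}) \<le> real h * (al (b t) * K)"
    proof (rule always_eventually, rule allI)
      fix t
      have bb: "b s = b t" if "s \<in> {b t..<t}" for s
      proof -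
        have "s div h = t div h"
        proof (rule div_nat_eqI)
          show "h * (t div h) \<le> s" using that by (simp add: b_def mult.commute)
          have "t < h * Suc (t div h)" unfolding mult_Suc_right by (rule dividend_less_times_div[OF h])
          then show "s < h * Suc (t div h)" using that by simp
        qed
        then show ?thesis by (simp add: b_def)
      qed
      have "norm (sum q {b t..<t}) \<le> (\<Sum>s\<in>{b t..<t}. al (b t) * K)"
      proof (rule order_trans[OF norm_sum sum_mono])
        fix s assume "s \<in> {b t..<t}"
        then have "b s = b t" by (rule bb)
        then have "norm (q s) = al (b t) * \<bar>G s\<bar>"
          using al(1)[of "b t"] by (simp add: q_def abs_mult)
        then show "norm (q s) \<le> al (b t) * K"
          using G[of s] al(1)[of "b t"] by simp
      qed
      also have "\<dots> = real (t - b t) * (al (b t) * K)" by simp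
      also have "\<dots> \<le> real h * (al (b t) * K)"
      proof -
        have "t - b t = t mod h" by (simp add: b_def minus_div_mult_eq_mod)
        then show ?thesis using h al(1)[of "b t"] K by (intro mult_right_mono) auto
      qed
      finally show "norm (sum q {b t..<t}) \<le> real h * (al (b t) * K)" .
    qed
  qed
  ultimately have "(\<lambda>t. R (t div h) + sum q {b t..<t}) \<longlonglongrightarrow> suminf (\<lambda>m. al (m * h) * (\<Sum>t\<in>{m*h..<m*h+h}. G t)) + 0"
    by (rule tendsto_add)
  moreover have "R (t div h) + sum q {b t..<t} = sum q {..<t}" for t
  proof -
    have "{..<t} = {..<b t} \<union> {b t..<t}" by (auto simp: b_def intro: less_le_trans[OF _ div_times_less_eq_dividend])
    then have "sum q {..<t} = sum q {..<b t} + sum q {b t..<t}"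
      by (simp add: sum.union_disjoint ivl_disj_int)
    then show ?thesis using R[of "t div h"] by (simp add: b_def)
  qed
  ultimately have "summable q" unfolding summable_def sums_def by auto
  with s1 have "summable (\<lambda>t. (al t - al (b t)) * G t + q t)" by (rule summable_add)
  then show ?thesis by (simp add: q_def algebra_simps)
qed

section \<open>Filtrations and conditional expectations\<close>

lemma space_pre_filt [simp]: "space (pre_filt M Z W t) = space M"
  unfolding pre_filt_def by (rule space_measure_of_conv)

lemma sets_pre_filt:
  "sets (pre_filt M Z W t) = sigma_sets (space M)
     ((\<Union>s<t. {Z s -` A \<inter> space M | A. A \<in> sets borel}) \<union>
      (\<Union>s<t. {W s -` B \<inter> space M | B. B \<in> sets borel}))"
  unfolding pre_filt_def by (intro sets_measure_of) auto

lemma subalgebra_pre_filt: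
  assumes "\<And>s. Z s \<in> borel_measurable M" "\<And>s. W s \<in> borel_measurable M"
  shows "subalgebra M (pre_filt M Z W t)"
  unfolding subalgebra_def sets_pre_filt
  using assms by (auto intro!: sets.sigma_sets_subset intro: measurable_sets)

lemma subalgebra_pre_filt_mono:
  assumes "s \<le> t"
  shows "subalgebra (pre_filt M Z W t) (pre_filt M Z W s)"
  unfolding subalgebra_def sets_pre_filt space_pre_filt
  using assms by (intro conjI refl sigma_sets_mono' Un_mono UN_mono) auto

lemma measurable_pre_filt:
  assumes "s < t"
  shows "Z s \<in> borel_measurable (pre_filt M Z W t)" "W s \<in> borel_measurable (pre_filt M Z W t)"
  unfolding measurable_def sets_pre_filt
  using assms by (auto intro!: sigma_sets.Basic)

text \<open>A nonnegative conditional expectation presupposes no integrability; integrating it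
  bounds the unconditional moment of order \<open>rho\<close>, and
  \<open>s\<^sup>2 \<le> 1 + s powr rho\<close> for nonnegative \<open>s\<close> passes to second
  moments. The sign of \<open>c\<close> is left open, hence \<open>\<bar>c\<bar>\<close>.\<close>

lemma (in prob_space) square_integrable_of_cond_moment:
  fixes X :: "'a \<Rightarrow> real^'r"
  assumes F: "subalgebra M F" and X[measurable]: "X \<in> borel_measurable M"
    and rho: "2 \<le> rho"
    and moment: "AE \<omega> in M. nn_cond_exp M F (\<lambda>\<omega>. ennreal (norm (X \<omega>) powr rho)) \<omega> \<le> ennreal c"
  shows "integrable M (\<lambda>\<omega>. (X \<omega> $ r)\<^sup>2)" "expectation (\<lambda>\<omega>. (X \<omega> $ r)\<^sup>2) \<le> 1 + \<bar>c\<bar>"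
proof -
  interpret finite_measure_subalgebra M F
    by unfold_locales (use F in auto)
  have [measurable]: "(\<lambda>\<omega>. X \<omega> $ r) \<in> borel_measurable M"
    by (intro measurable_compose[OF X] borel_measurable_continuous_onI continuous_intros)
  have le: "(X \<omega> $ r)\<^sup>2 \<le> 1 + norm (X \<omega>) powr rho" for \<omega>
  proof -
    have "(X \<omega> $ r)\<^sup>2 \<le> (norm (X \<omega>))\<^sup>2"
      using component_le_norm_cart[of "X \<omega>" r] by (simp add: abs_le_square_iff[symmetric])
    also have "\<dots> \<le> 1 + norm (X \<omega>) powr rho"
    proof (cases "norm (X \<omega>) \<le> 1")
      case True
      then have "(norm (X \<omega>))\<^sup>2 \<le> 1" by (simp add: power_le_one)
      then show ?thesis using powr_ge_zero[of "norm (X \<omega>)" rho] by linarith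
    next
      case False
      then have "(norm (X \<omega>))\<^sup>2 = norm (X \<omega>) powr 2" by simp
      also have "\<dots> \<le> norm (X \<omega>) powr rho" using False rho by (intro powr_mono) auto
      finally show ?thesis by simp
    qed
    finally show ?thesis .
  qed
  have "(\<integral>\<^sup>+\<omega>. ennreal ((X \<omega> $ r)\<^sup>2) \<partial>M) \<le> (\<integral>\<^sup>+\<omega>. 1 + ennreal (norm (X \<omega>) powr rho) \<partial>M)"
    using le by (intro nn_integral_mono) (metis ennreal_1 ennreal_leI ennreal_plus powr_ge_zero zero_le_one)
  also have "\<dots> = 1 + (\<integral>\<^sup>+\<omega>. ennreal (norm (X \<omega>) powr rho) \<partial>M)"
    by (subst nn_integral_add) (auto simp: emeasure_space_1)
  also have "(\<integral>\<^sup>+\<omega>. ennreal (norm (X \<omega>) powr rho) \<partial>M) =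
      (\<integral>\<^sup>+\<omega>. nn_cond_exp M F (\<lambda>\<omega>. ennreal (norm (X \<omega>) powr rho)) \<omega> \<partial>M)"
    using nn_cond_exp_intg[of "\<lambda>_. 1" "\<lambda>\<omega>. ennreal (norm (X \<omega>) powr rho)"] by simp
  also have "\<dots> \<le> (\<integral>\<^sup>+\<omega>. ennreal \<bar>c\<bar> \<partial>M)"
    by (intro nn_integral_mono_AE AE_mp[OF moment AE_I2]) (auto elim!: order_trans intro: ennreal_leI)
  also have "\<dots> = ennreal \<bar>c\<bar>" by (simp add: emeasure_space_1)
  finally have *: "(\<integral>\<^sup>+\<omega>. ennreal ((X \<omega> $ r)\<^sup>2) \<partial>M) \<le> ennreal (1 + \<bar>c\<bar>)"
    by (simp add: ennreal_plus)
  then show "integrable M (\<lambda>\<omega>. (X \<omega> $ r)\<^sup>2)"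
    by (intro integrableI_nonneg) (measurable, auto intro: le_less_trans)
  show "expectation (\<lambda>\<omega>. (X \<omega> $ r)\<^sup>2) \<le> 1 + \<bar>c\<bar>"
    using * by (intro integral_real_bounded) auto
qed

section \<open>Freezing an independent multiplier\<close>

lemma pred_summable:
  fixes f :: "nat \<Rightarrow> 'a \<Rightarrow> real"
  assumes [measurable]: "\<And>t. f t \<in> borel_measurable N"
  shows "Measurable.pred N (\<lambda>\<omega>. summable (\<lambda>t. f t \<omega>))"
  unfolding summable_iff_convergent Cauchy_convergent_iff[symmetric] pred_def
  by (rule sets_Collect_Cauchy) measurable

text \<open>Fubini needs independence as an identity of laws. The preimage form gives the product
  formula on rectangles, and these determine the product measure.\<close>

lemma (in prob_space) distr_pair_eq_of_indep_set:
  assumes X[measurable]: "X \<in> measurable M S" and Y[measurable]: "Y \<in> measurable M T"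
    and indep: "indep_set {X -` A \<inter> space M | A. A \<in> sets S} {Y -` B \<inter> space M | B. B \<in> sets T}"
  shows "distr M S X \<Otimes>\<^sub>M distr M T Y = distr M (S \<Otimes>\<^sub>M T) (\<lambda>\<omega>. (X \<omega>, Y \<omega>))"
proof -
  interpret X: prob_space "distr M S X" by (rule prob_space_distr) simp
  interpret Y: prob_space "distr M T Y" by (rule prob_space_distr) simp
  show ?thesis
  proof (rule pair_measure_eqI[OF X.sigma_finite_measure_axioms Y.sigma_finite_measure_axioms])
    fix A B assume "A \<in> sets (distr M S X)" "B \<in> sets (distr M T Y)"
    then have [measurable]: "A \<in> sets S" "B \<in> sets T" by auto
    have "prob ((X -` A \<inter> space M) \<inter> (Y -` B \<inter> space M)) = prob (X -` A \<inter> space M) * prob (Y -` B \<inter> space M)"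
      by (rule indep_setD[OF indep]) (use \<open>A \<in> sets S\<close> \<open>B \<in> sets T\<close> in blast)+
    moreover have "(\<lambda>\<omega>. (X \<omega>, Y \<omega>)) -` (A \<times> B) \<inter> space M = (X -` A \<inter> space M) \<inter> (Y -` B \<inter> space M)"
      by auto
    ultimately show "emeasure (distr M S X) A * emeasure (distr M T Y) B =
        emeasure (distr M (S \<Otimes>\<^sub>M T) (\<lambda>\<omega>. (X \<omega>, Y \<omega>))) (A \<times> B)"
      by (simp add: emeasure_distr emeasure_eq_measure ennreal_mult)
  qed simp
qed

text \<open>By independence the joint law of \<open>(D, V)\<close> is a product, so \<open>D\<close> may be frozen by Fubini; only the
  martingale property of \<open>V\<close> is then needed.\<close>

lemma (in prob_space) AE_summable_independent_multiplier:
  fixes D :: "nat \<Rightarrow> 'a \<Rightarrow> 'd::topological_space" and V :: "nat \<Rightarrow> 'a \<Rightarrow> 'v::topological_space"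
    and \<phi> :: "'d \<Rightarrow> real" and \<psi> :: "'v \<Rightarrow> real"
  assumes D[measurable]: "\<And>t. D t \<in> borel_measurable M" and V[measurable]: "\<And>t. V t \<in> borel_measurable M"
    and indep: "indep_set
        {(\<lambda>\<omega> t. D t \<omega>) -` A \<inter> space M | A. A \<in> sets (PiM UNIV (\<lambda>_. borel))}
        {(\<lambda>\<omega> t. V t \<omega>) -` B \<inter> space M | B. B \<in> sets (PiM UNIV (\<lambda>_. borel))}"
    and \<phi>[measurable]: "\<phi> \<in> borel_measurable borel" and \<psi>[measurable]: "\<psi> \<in> borel_measurable borel"
    and bound: "AE \<omega> in M. \<forall>t. \<bar>\<phi> (D t \<omega>)\<bar> \<le> K"
    and mds: "mds M (\<lambda>t \<omega>. \<psi> (V t \<omega>)) F"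
    and second: "\<And>t. expectation (\<lambda>\<omega>. (\<psi> (V t \<omega>))\<^sup>2) \<le> C"
    and c: "summable (\<lambda>t. (c t)\<^sup>2)"
  shows "AE \<omega> in M. summable (\<lambda>t. c t * \<phi> (D t \<omega>) * \<psi> (V t \<omega>))"
proof -
  interpret V: mds M "\<lambda>t \<omega>. \<psi> (V t \<omega>)" F by (fact mds)
  define S where "S = PiM (UNIV :: nat set) (\<lambda>_. borel :: 'd measure)"
  define T where "T = PiM (UNIV :: nat set) (\<lambda>_. borel :: 'v measure)"
  define XD where "XD = (\<lambda>\<omega> t. D t \<omega>)"
  define XV where "XV = (\<lambda>\<omega> t. V t \<omega>)"
  have XD[measurable]: "XD \<in> measurable M S" unfolding XD_def S_def by (intro measurable_abs_UNIV D)
  have XV[measurable]: "XV \<in> measurable M T" unfolding XV_def T_def by (intro measurable_abs_UNIV V)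
  have joint: "distr M S XD \<Otimes>\<^sub>M distr M T XV = distr M (S \<Otimes>\<^sub>M T) (\<lambda>\<omega>. (XD \<omega>, XV \<omega>))"
    using indep by (intro distr_pair_eq_of_indep_set XD XV) (simp add: XD_def XV_def S_def T_def)
  interpret PD: prob_space "distr M S XD" by (rule prob_space_distr) simp
  interpret PV: prob_space "distr M T XV" by (rule prob_space_distr) simp
  interpret DV: pair_sigma_finite "distr M S XD" "distr M T XV" ..
  \<comment> \<open>The bound on the multiplier is a premise inside \<open>?P\<close>, so the claim
    holds for every frozen \<open>d\<close>, vacuously if the bound fails, and no null set of
    sequences must be excluded before Fubini.\<close>
  let ?P = "\<lambda>p. (\<forall>t. \<bar>\<phi> (fst p t)\<bar> \<le> K) \<longrightarrow> summable (\<lambda>t. c t * \<phi> (fst p t) * \<psi> (snd p t))"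
  have 1[measurable]: "(\<lambda>p. \<phi> (fst p t)) \<in> borel_measurable (S \<Otimes>\<^sub>M T)" for t
    unfolding S_def by (intro measurable_compose[OF _ \<phi>] measurable_compose[OF measurable_fst measurable_component_singleton]) simp
  have 2[measurable]: "(\<lambda>p. \<psi> (snd p t)) \<in> borel_measurable (S \<Otimes>\<^sub>M T)" for t
    unfolding T_def by (intro measurable_compose[OF _ \<psi>] measurable_compose[OF measurable_snd measurable_component_singleton]) simp
  have P[measurable]: "Measurable.pred (S \<Otimes>\<^sub>M T) ?P"
    by (intro pred_intros_logic pred_intros_countable pred_summable borel_measurable_times borel_measurable_const 1 2)
       measurable
  have "AE d in distr M S XD. AE v in distr M T XV. ?P (d, v)"
  proof (rule AE_I2)
    fix d
    have Q: "Measurable.pred T (\<lambda>v. ?P (d, v))"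
      unfolding T_def fst_conv snd_conv by (intro pred_intros_logic pred_intros_countable pred_summable) measurable
    have "AE \<omega> in M. ?P (d, XV \<omega>)"
    proof (cases "\<forall>t. \<bar>\<phi> (d t)\<bar> \<le> K")
      case True
      \<comment> \<open>For fixed \<open>d\<close> the factor is a number, so the products are
        martingale differences for the original \<open>F\<close>, although
        \<open>\<phi> (D t \<omega>)\<close> need not be known to \<open>F t\<close>.\<close>
      define b where "b t = c t * \<phi> (d t)" for t
      interpret X: mds M "\<lambda>t \<omega>. b t * \<psi> (V t \<omega>)" F
      proof
        fix t
        interpret sub: finite_measure_subalgebra M "F t" by unfold_locales (rule V.subalg)
        have "integrable M (\<lambda>\<omega>. \<psi> (V t \<omega>))"
          using integrable_mult_of_square_integrable[OF V.meas borel_measurable_const V.square_int, of 1 t] by simp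
        then have "AE \<omega> in M. real_cond_exp M (F t) (\<lambda>\<omega>. b t * \<psi> (V t \<omega>)) \<omega> = b t * real_cond_exp M (F t) (\<lambda>\<omega>. \<psi> (V t \<omega>)) \<omega>"
          by (rule sub.real_cond_exp_cmult)
        with V.cond_zero[of t] show "AE \<omega> in M. real_cond_exp M (F t) (\<lambda>\<omega>. b t * \<psi> (V t \<omega>)) \<omega> = 0"
          by eventually_elim simp
        show "integrable M (\<lambda>\<omega>. (b t * \<psi> (V t \<omega>))\<^sup>2)" using V.square_int[of t] by (simp add: power_mult_distrib)
      next
        fix s t :: nat assume "s < t"
        then show "(\<lambda>\<omega>. b s * \<psi> (V s \<omega>)) \<in> borel_measurable (F t)"
          using V.adapted[of s t] by (intro borel_measurable_times) auto
      qed (use V.subalg in auto)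
      have "summable (\<lambda>t. expectation (\<lambda>\<omega>. (b t * \<psi> (V t \<omega>))\<^sup>2))"
      proof (rule summable_comparison_test')
        show "summable (\<lambda>t. (c t)\<^sup>2 * (K\<^sup>2 * C))" using c by (rule summable_mult2)
        fix t
        have "(\<phi> (d t))\<^sup>2 \<le> K\<^sup>2" using power_mono[of "\<bar>\<phi> (d t)\<bar>" K 2] True by simp
        then have "(b t)\<^sup>2 * expectation (\<lambda>\<omega>. (\<psi> (V t \<omega>))\<^sup>2) \<le> ((c t)\<^sup>2 * K\<^sup>2) * C"
          unfolding b_def power_mult_distrib
          by (intro mult_mono mult_left_mono second) auto
        then show "norm (expectation (\<lambda>\<omega>. (b t * \<psi> (V t \<omega>))\<^sup>2)) \<le> (c t)\<^sup>2 * (K\<^sup>2 * C)"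
          by (simp add: power_mult_distrib mult.assoc)
      qed
      from X.AE_summable[OF this] show ?thesis by (simp add: b_def XV_def)
    next
      case False
      then show ?thesis by (intro AE_I2 impI) simp
    qed
    then show "AE v in distr M T XV. ?P (d, v)" by (simp only: AE_distr_iff[OF XV Q[unfolded pred_def]])
  qed
  moreover have "{p \<in> space (distr M S XD \<Otimes>\<^sub>M distr M T XV). ?P p} \<in> sets (distr M S XD \<Otimes>\<^sub>M distr M T XV)"
  proof -
    have eq: "sets (distr M S XD \<Otimes>\<^sub>M distr M T XV) = sets (S \<Otimes>\<^sub>M T)"
      by (rule sets_pair_measure_cong) simp_all
    show ?thesis unfolding eq sets_eq_imp_space_eq[OF eq] using P unfolding pred_def .
  qed
  ultimately have "AE p in distr M S XD \<Otimes>\<^sub>M distr M T XV. ?P p"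
    by (intro DV.AE_pair_measure)
  then have "AE \<omega> in M. ?P (XD \<omega>, XV \<omega>)"
    unfolding joint by (simp only: AE_distr_iff[OF measurable_Pair[OF XD XV] P[unfolded pred_def]])
  with bound show ?thesis by eventually_elim (simp add: XD_def XV_def)
qed

section \<open>Deviations from predictions at block starts\<close>

lemma (in prob_space) AE_abs_real_cond_exp_le:
  assumes F: "subalgebra M F" and [measurable]: "q \<in> borel_measurable M" and "AE \<omega> in M. \<bar>q \<omega>\<bar> \<le> K"
  shows "AE \<omega> in M. \<bar>real_cond_exp M F q \<omega>\<bar> \<le> K"
proof -
  interpret finite_measure_subalgebra M F by unfold_locales (rule F)
  have int: "integrable M q" using assms by (intro integrable_const_bound[of q K]) auto
  have "AE \<omega> in M. - K \<le> real_cond_exp M F q \<omega>"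
    by (rule real_cond_exp_ge_c[OF int]) (use assms(3) in \<open>auto elim!: AE_mp\<close>)
  moreover have "AE \<omega> in M. real_cond_exp M F q \<omega> \<le> K"
    by (rule real_cond_exp_le_c[OF int]) (use assms(3) in \<open>auto elim!: AE_mp\<close>)
  ultimately show ?thesis by eventually_elim auto
qed

text \<open>Late in a block, \<open>q t\<close> minus its prediction from the block start is in
  general not centred given \<open>P t\<close>. The increments are therefore whole block sums:
  centred given \<open>P (m * h)\<close> and known at the next block start. Boundedness makes their
  second moments of order \<open>(a m)\<^sup>2\<close>.\<close>

lemma (in prob_space) AE_summable_block_deviations:
  fixes q :: "nat \<Rightarrow> 'a \<Rightarrow> real"
  assumes P: "\<And>t. subalgebra M (P t)" and mono: "\<And>s t. s \<le> t \<Longrightarrow> subalgebra (P t) (P s)"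
    and adapted: "\<And>s t. s < t \<Longrightarrow> q s \<in> borel_measurable (P t)"
    and bound: "\<And>t. AE \<omega> in M. \<bar>q t \<omega>\<bar> \<le> K"
    and a: "summable (\<lambda>m. (a m)\<^sup>2)"
  shows "AE \<omega> in M. summable (\<lambda>m. a m * (\<Sum>t\<in>{m*h..<m*h+h}. q t \<omega> - real_cond_exp M (P (m*h)) (q t) \<omega>))"
proof -
  have q[measurable]: "q t \<in> borel_measurable M" for t
    using measurable_from_subalg[OF P adapted[of t "Suc t"]] by simp
  have int: "integrable M (q t)" for t by (intro integrable_const_bound[of "q t" K]) (use bound in auto)
  define X where "X m \<omega> = a m * (\<Sum>t\<in>{m*h..<m*h+h}. q t \<omega> - real_cond_exp M (P (m*h)) (q t) \<omega>)" for m \<omega>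
  have X[measurable]: "X m \<in> borel_measurable M" for m
    unfolding X_def by measurable
  have X_bound: "AE \<omega> in M. (X m \<omega>)\<^sup>2 \<le> (a m)\<^sup>2 * (real h * (2 * K))\<^sup>2" for m
  proof -
    have "AE \<omega> in M. \<forall>t\<in>{m*h..<m*h+h}. \<bar>q t \<omega>\<bar> \<le> K \<and> \<bar>real_cond_exp M (P (m*h)) (q t) \<omega>\<bar> \<le> K"
      by (intro AE_finite_allI AE_conjI bound AE_abs_real_cond_exp_le P q) auto
    then show ?thesis
    proof eventually_elim
      case (elim \<omega>)
      have "\<bar>\<Sum>t\<in>{m*h..<m*h+h}. q t \<omega> - real_cond_exp M (P (m*h)) (q t) \<omega>\<bar> \<le> (\<Sum>t\<in>{m*h..<m*h+h}. 2 * K)"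
        by (rule order_trans[OF sum_abs sum_mono])
           (use elim in \<open>fastforce intro: order_trans[OF abs_triangle_ineq4]\<close>)
      then have "(\<Sum>t\<in>{m*h..<m*h+h}. q t \<omega> - real_cond_exp M (P (m*h)) (q t) \<omega>)\<^sup>2 \<le> (real h * (2 * K))\<^sup>2"
        by (subst abs_le_square_iff[symmetric]) simp
      then show ?case unfolding X_def power_mult_distrib[of "a m"] by (rule mult_left_mono) simp
    qed
  qed
  have X_int: "integrable M (\<lambda>\<omega>. (X m \<omega>)\<^sup>2)" for m
    by (intro integrable_const_bound[of _ "(a m)\<^sup>2 * (real h * (2 * K))\<^sup>2"]) (use X_bound[of m] in auto)
  interpret mds M X "\<lambda>m. P (m*h)"
  proof
    fix m
    interpret sub: finite_measure_subalgebra M "P (m*h)" by unfold_locales (rule P)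
    define Y where "Y \<omega> = (\<Sum>t\<in>{m*h..<m*h+h}. q t \<omega>)" for \<omega>
    define R where "R \<omega> = (\<Sum>t\<in>{m*h..<m*h+h}. real_cond_exp M (P (m*h)) (q t) \<omega>)" for \<omega>
    have X_eq: "X m = (\<lambda>\<omega>. a m * (Y \<omega> - R \<omega>))" by (simp add: X_def Y_def R_def sum_subtractf fun_eq_iff)
    have Y: "integrable M Y" unfolding Y_def using int by auto
    have R: "integrable M R" "R \<in> borel_measurable (P (m*h))"
      unfolding R_def using int
      by (auto intro!: integrable_sum borel_measurable_sum sub.real_cond_exp_int borel_measurable_cond_exp)
    have "AE \<omega> in M. real_cond_exp M (P (m*h)) (X m) \<omega> = a m * real_cond_exp M (P (m*h)) (\<lambda>\<omega>. Y \<omega> - R \<omega>) \<omega>"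
      unfolding X_eq using Y R by (intro sub.real_cond_exp_cmult) auto
    moreover have "AE \<omega> in M. real_cond_exp M (P (m*h)) (\<lambda>\<omega>. Y \<omega> - R \<omega>) \<omega>
        = real_cond_exp M (P (m*h)) Y \<omega> - real_cond_exp M (P (m*h)) R \<omega>"
      using Y R by (intro sub.real_cond_exp_diff)
    moreover have "AE \<omega> in M. real_cond_exp M (P (m*h)) R \<omega> = R \<omega>"
      using R by (intro sub.real_cond_exp_F_meas)
    moreover have "AE \<omega> in M. real_cond_exp M (P (m*h)) Y \<omega> = R \<omega>"
      unfolding Y_def R_def using int by (intro sub.real_cond_exp_sum)
    ultimately show "AE \<omega> in M. real_cond_exp M (P (m*h)) (X m) \<omega> = 0" by eventually_elim simp
  next
    fix k m :: nat assume "k < m"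
    \<comment> \<open>Every index of block \<open>k\<close> is strictly below \<open>m * h\<close>,
      as \<open>adapted\<close> requires.\<close>
    then have km: "k * h + h \<le> m * h" using mult_le_mono1[of "Suc k" m h] by simp
    have "real_cond_exp M (P (k*h)) (q t) \<in> borel_measurable (P (m*h))" for t
      using \<open>k < m\<close> by (intro measurable_from_subalg[OF mono borel_measurable_cond_exp]) auto
    moreover have "q t \<in> borel_measurable (P (m*h))" if "t \<in> {k*h..<k*h+h}" for t
      using that km by (intro adapted) auto
    ultimately show "X k \<in> borel_measurable (P (m*h))"
      unfolding X_def by (intro borel_measurable_times borel_measurable_sum borel_measurable_diff) auto
  qed (use P X_int in auto)
  have "summable (\<lambda>m. expectation (\<lambda>\<omega>. (X m \<omega>)\<^sup>2))"
  proof (rule summable_comparison_test')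
    show "summable (\<lambda>m. (a m)\<^sup>2 * (real h * (2 * K))\<^sup>2)" using a by (rule summable_mult2)
    have "expectation (\<lambda>\<omega>. (X m \<omega>)\<^sup>2) \<le> expectation (\<lambda>\<omega>. (a m)\<^sup>2 * (real h * (2 * K))\<^sup>2)" for m
      by (intro integral_mono_AE X_int X_bound) auto
    then show "norm (expectation (\<lambda>\<omega>. (X m \<omega>)\<^sup>2)) \<le> (a m)\<^sup>2 * (real h * (2 * K))\<^sup>2" for m
      by (simp add: prob_space)
  qed
  from AE_summable[OF this] show ?thesis by (simp add: X_def)
qed

section \<open>The estimation error along a path\<close>

lemma norm_matrix_le_entries:
  fixes A :: "real^'c^'r"
  assumes "\<And>p q. \<bar>A $ p $ q\<bar> \<le> k"
  shows "norm A \<le> real CARD('r) * (real CARD('c) * k)"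
proof -
  have "norm A \<le> (\<Sum>p\<in>UNIV. norm (A $ p))"
    unfolding norm_vec_def[of A] by (rule L2_set_le_sum) simp
  also have "\<dots> \<le> (\<Sum>p\<in>(UNIV::'r set). \<Sum>q\<in>(UNIV::'c set). k)"
    by (intro sum_mono order_trans[OF norm_le_l1_cart] assms)
  finally show ?thesis by simp
qed

lemma summable_vec:
  fixes f :: "nat \<Rightarrow> 'b::real_normed_vector^'k"
  assumes "\<And>i. summable (\<lambda>t. f t $ i)"
  shows "summable f"
proof -
  have "(\<lambda>n. \<Sum>t<n. f t) \<longlonglongrightarrow> (\<chi> i. \<Sum>t. f t $ i)"
    by (rule vec_tendstoI) (use assms in \<open>simp add: summable_LIMSEQ\<close>)
  then show ?thesis unfolding summable_def sums_def by blast
qed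

lemma inner_skew_eq_zero:
  fixes K :: "real^'k^'k"
  assumes "transpose K = - K"
  shows "y \<bullet> (K *v y) = 0"
proof -
  have "y \<bullet> (K *v y) = (transpose K *v y) \<bullet> y"
    by (simp add: dot_lmul_matrix transpose_matrix_vector)
  also have "\<dots> = - (y \<bullet> (K *v y))"
    unfolding assms by (simp add: inner_vec_def matrix_vector_mult_def sum_negf mult.commute)
  finally show ?thesis by simp
qed

section \<open>Matrix form of the error dynamics\<close>

lemma kron_laplacian_mult:
  fixes a :: "'n::finite \<Rightarrow> 'n \<Rightarrow> real" and e :: "real^('n \<times> 'm::finite)"
  shows "(kron (laplacian a) (mat 1) *v e) $ (i, k) = (\<Sum>j\<in>UNIV. a i j * (e $ (i, k) - e $ (j, k)))"
proof -
  have "(kron (laplacian a) (mat 1) *v e) $ (i, k)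
      = (\<Sum>j\<in>UNIV. \<Sum>l\<in>UNIV. laplacian a $ i $ j * (mat 1 :: real^'m^'m) $ k $ l * e $ (j, l))"
    by (simp add: matrix_vector_mult_def kron_def sum.cartesian_product flip: UNIV_Times_UNIV)
       (rule sum.cong, auto)
  also have "\<dots> = (\<Sum>j\<in>UNIV. laplacian a $ i $ j * e $ (j, k))"
  proof (rule sum.cong[OF refl])
    fix j
    have "(\<Sum>l\<in>UNIV. laplacian a $ i $ j * (mat 1 :: real^'m^'m) $ k $ l * e $ (j, l))
        = (\<Sum>l\<in>UNIV. if k = l then laplacian a $ i $ j * e $ (j, l) else 0)"
      by (rule sum.cong) (auto simp: mat_def)
    then show "(\<Sum>l\<in>UNIV. laplacian a $ i $ j * (mat 1 :: real^'m^'m) $ k $ l * e $ (j, l))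
        = laplacian a $ i $ j * e $ (j, k)" by simp
  qed
  also have "\<dots> = (\<Sum>j\<in>UNIV. (if i = j then (\<Sum>l\<in>UNIV. a i l) * e $ (j, k) else 0) - a i j * e $ (j, k))"
    by (rule sum.cong) (auto simp: laplacian_def algebra_simps)
  also have "\<dots> = (\<Sum>j\<in>UNIV. a i j * (e $ (i, k) - e $ (j, k)))"
    by (simp add: sum_subtractf right_diff_distrib sum_distrib_right)
  finally show ?thesis .
qed

lemma DH_mat_transpose_mult:
  fixes e :: "real^('n::finite \<times> 'm::finite)"
  shows "(transpose (DH_mat own H) *v e) $ r = H r \<bullet> (\<chi> l. e $ (own r, l))"
proof -
  have "(transpose (DH_mat own H) *v e) $ r
      = (\<Sum>j\<in>UNIV. \<Sum>l\<in>UNIV. (if own r = j then H r $ l else 0) * e $ (j, l))"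
    by (simp add: matrix_vector_mult_def DH_mat_def transpose_def sum.cartesian_product flip: UNIV_Times_UNIV)
       (rule sum.cong, auto)
  also have "\<dots> = (\<Sum>j\<in>UNIV. if own r = j then (\<Sum>l\<in>UNIV. H r $ l * e $ (j, l)) else 0)"
    by (rule sum.cong) auto
  also have "\<dots> = H r \<bullet> (\<chi> l. e $ (own r, l))" by (simp add: inner_vec_def)
  finally show ?thesis .
qed

lemma DH_mat_mult: "(DH_mat own H *v w) $ (i, k) = (\<Sum>r\<in>{r. own r = i}. w $ r * H r $ k)"
proof -
  have "(DH_mat own H *v w) $ (i, k) = (\<Sum>r\<in>UNIV. if own r = i then w $ r * H r $ k else 0)"
    unfolding matrix_vector_mult_def DH_mat_def by (auto intro: sum.cong)
  then show ?thesis by (simp add: sum.If_cases)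
qed

text \<open>With \<open>q\<close> the increment of \<open>1 / al\<close>, the ratio is exactly
  \<open>1 + al t * q t\<close>, and the power has derivative \<open>delta\<close> there in the
  limit. The resulting first-order coefficient is the drift caused by rescaling the error at each
  step.\<close>

lemma scaling_ratio_asymptotics:
  fixes al :: "nat \<Rightarrow> real"
  assumes pos: "\<And>t. al t > 0" and lim: "al \<longlonglongrightarrow> 0"
    and diff: "(\<lambda>t. 1 / al (Suc t) - 1 / al t) \<longlonglongrightarrow> alpha0"
  shows "(\<lambda>t. (al t / al (Suc t)) powr delta) \<longlonglongrightarrow> 1"
    and "(\<lambda>t. ((al t / al (Suc t)) powr delta - 1) / al t) \<longlonglongrightarrow> alpha0 * delta"
proof -
  define q where "q t = 1 / al (Suc t) - 1 / al t" for t
  have q: "q \<longlonglongrightarrow> alpha0" using diff by (simp add: q_def[abs_def])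
  have ratio: "al t / al (Suc t) = 1 + al t * q t" for t
    using pos[of t] pos[of "Suc t"] by (simp add: q_def field_simps)
  have small: "(\<lambda>t. al t * q t) \<longlonglongrightarrow> 0" using tendsto_mult[OF lim q] by simp
  have "(\<lambda>t. (1 + al t * q t) powr delta) \<longlonglongrightarrow> (1 + 0) powr delta"
    by (intro tendsto_intros small) auto
  then show "(\<lambda>t. (al t / al (Suc t)) powr delta) \<longlonglongrightarrow> 1" by (simp add: ratio)
  have "((\<lambda>s. (1 + s) powr delta) has_real_derivative delta) (at 0)"
    by (auto intro!: derivative_eq_intros)
  then obtain g where g: "\<And>s. (1 + s) powr delta - (1 + 0) powr delta = g s * (s - 0)" "isCont g 0" "g 0 = delta"
    unfolding CARAT_DERIV by blast
  have "(\<lambda>t. g (al t * q t) * q t) \<longlonglongrightarrow> g 0 * alpha0"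
    using g(2) by (intro tendsto_mult q isCont_tendsto_compose[OF _ small])
  moreover have "((al t / al (Suc t)) powr delta - 1) / al t = g (al t * q t) * q t" for t
    using g(1)[of "al t * q t"] pos[of t] by (simp add: ratio)
  ultimately show "(\<lambda>t. ((al t / al (Suc t)) powr delta - 1) / al t) \<longlonglongrightarrow> alpha0 * delta"
    by (simp add: g(3) mult.commute)
qed

text \<open>An event resets the gap to zero, and without an event the gap is within the threshold by
  the triggering rule; at time \<open>0\<close> both sequences agree.\<close>

lemma triggering_error_le:
  fixes x xh :: "nat \<Rightarrow> 'n \<Rightarrow> real^'m"
  assumes "x 0 = xh 0" and f: "\<And>i t. 0 \<le> f i t"
    and "\<And>t i. xh (Suc t) i = (if norm (x (Suc t) i - xh t i) > f i (Suc t) then x (Suc t) i else xh t i)"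
  shows "norm (xh t i - x t i) \<le> f i t"
  using assms by (cases t) (auto simp: norm_minus_commute)

text \<open>The consensus term splits as
  \<open>xh t j - x t i = (xh t j - x t j) + (x t j - x t i)\<close>. In the second difference
  \<open>theta\<close> cancels, which yields the Laplacian acting on the error; the first is the
  triggering disturbance. The residual of row \<open>r\<close> is likewise \<open>v $ r\<close>
  minus \<open>H r\<close> applied to the error. The form is componentwise because sensors have
  their own step sizes.\<close>

lemma error_recursion:
  fixes a :: "'n::finite \<Rightarrow> 'n \<Rightarrow> real" and x xh :: "nat \<Rightarrow> 'n \<Rightarrow> real^'m::finite" and E :: "nat \<Rightarrow> real^('n \<times> 'm)"
  assumes a: "\<And>i j. a i j \<ge> 0"
    and step: "x (Suc t) i = x t i
        + alpha *\<^sub>R (\<Sum>r\<in>{r. own r = i}. ((H r \<bullet> theta + v $ r) - H r \<bullet> x t i) *\<^sub>R H r)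
        + alpha *\<^sub>R (\<Sum>j\<in>{j. a i j > 0}. a i j *\<^sub>R (xh t j - x t i))"
    and E: "\<And>t. E t = (\<chi> p. x t (fst p) $ snd p) - (\<chi> p. theta $ snd p)"
  shows "E (Suc t) $ (i, k) = E t $ (i, k)
    - alpha * (((kron (laplacian a) (mat 1) + DH_mat own H ** transpose (DH_mat own H)) *v E t) $ (i, k))
    + alpha * ((DH_mat own H *v v) $ (i, k)) + alpha * (\<Sum>j\<in>UNIV. a i j * (xh t j $ k - x t j $ k))"
proof -
  have Ecomp: "E t $ (j, l) = x t j $ l - theta $ l" for t j l by (simp add: E)
  have blk: "(\<chi> l. E t $ (j, l)) = x t j - theta" for j by (simp add: vec_eq_iff Ecomp)
  have A: "(\<Sum>j\<in>{j. a i j > 0}. a i j *\<^sub>R (xh t j - x t i)) $ k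
      = (\<Sum>j\<in>UNIV. a i j * (xh t j $ k - x t j $ k)) - (kron (laplacian a) (mat 1) *v E t) $ (i, k)"
  proof -
    have "(\<Sum>j\<in>{j. a i j > 0}. a i j *\<^sub>R (xh t j - x t i)) = (\<Sum>j\<in>UNIV. a i j *\<^sub>R (xh t j - x t i))"
      using a by (intro sum.mono_neutral_left) (auto simp: not_less antisym)
    then show ?thesis
      by (simp add: kron_laplacian_mult Ecomp sum_component flip: sum_subtractf) (simp add: algebra_simps)
  qed
  have B: "(\<Sum>r\<in>{r. own r = i}. ((H r \<bullet> theta + v $ r) - H r \<bullet> x t i) *\<^sub>R H r) $ k
      = (DH_mat own H *v v) $ (i, k) - ((DH_mat own H ** transpose (DH_mat own H)) *v E t) $ (i, k)"
    unfolding matrix_vector_mul_assoc[symmetric] DH_mat_mult DH_mat_transpose_mult blk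
    by (simp add: sum_component flip: sum_subtractf)
       (auto intro!: sum.cong simp: blk inner_diff_right algebra_simps)
  show ?thesis
    unfolding Ecomp[of "Suc t"] step
    by (simp only: vector_add_component vector_scaleR_component A B matrix_vector_mult_add_rdistrib)
       (simp add: Ecomp algebra_simps)
qed

lemma summable_square_of_powr:
  fixes al :: "nat \<Rightarrow> real"
  assumes pos: "\<And>t. al t > 0" and lim: "al \<longlonglongrightarrow> 0" and delta: "0 \<le> delta"
    and sm: "summable (\<lambda>t. al t powr (2 * (1 - delta)))"
  shows "summable (\<lambda>t. (al t)\<^sup>2)"
proof (rule summable_comparison_test_ev[OF _ sm])
  have "\<forall>\<^sub>F t in sequentially. al t < 1" using lim by (rule order_tendstoD(2)) simp
  then show "\<forall>\<^sub>F t in sequentially. norm ((al t)\<^sup>2) \<le> al t powr (2 * (1 - delta))"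
  proof eventually_elim
    case (elim t)
    have "(al t)\<^sup>2 = al t powr 2" using pos[of t] by simp
    also have "\<dots> \<le> al t powr (2 * (1 - delta))"
      using elim pos[of t] delta by (intro powr_mono') auto
    finally show ?case by simp
  qed
qed

text \<open>A deterministic statement about one path: chance enters only through path properties
  such as \<open>noise\<close>, \<open>dev\<close> and the coercivity \<open>C_ge\<close>.
  \<open>C m\<close> stands for the conditional sum of \<open>Q\<close> over block
  \<open>m\<close>.\<close>

lemma scaled_error_tendsto_zero:
  fixes a :: "'n::finite \<Rightarrow> 'n \<Rightarrow> real"
    and own :: "'r::finite \<Rightarrow> 'n"
    and theta :: "real^'m::finite"
    and H :: "nat \<Rightarrow> 'r \<Rightarrow> real^'m"
    and V :: "nat \<Rightarrow> real^'r"
    and x xh :: "nat \<Rightarrow> 'n \<Rightarrow> real^'m"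
    and alpha f :: "'n \<Rightarrow> nat \<Rightarrow> real"
    and al :: "nat \<Rightarrow> real"
    and C :: "nat \<Rightarrow> real^('n \<times> 'm)^('n \<times> 'm)"
  defines "D t \<equiv> DH_mat own (H t)"
  defines "Q t \<equiv> kron (sym_laplacian a) (mat 1) + D t ** transpose (D t)"
  assumes a: "\<And>i j. a i j \<ge> 0" and f: "\<And>i t. f i t \<ge> 0"
    and init: "x 0 = xh 0"
    and xh_step: "\<And>t i. xh (Suc t) i =
        (if norm (x (Suc t) i - xh t i) > f i (Suc t) then x (Suc t) i else xh t i)"
    and x_step: "\<And>t i. x (Suc t) i = x t i
        + alpha i t *\<^sub>R (\<Sum>r\<in>{r. own r = i}. ((H t r \<bullet> theta + V t $ r) - H t r \<bullet> x t i) *\<^sub>R H t r)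
        + alpha i t *\<^sub>R (\<Sum>j\<in>{j. a i j > 0}. a i j *\<^sub>R (xh t j - x t i))"
    and alpha_pos: "\<And>i t. alpha i t > 0"
    and al: "\<And>t. al t > 0" "al \<longlonglongrightarrow> 0" "\<not> summable al" "summable (\<lambda>t. (al t)\<^sup>2)"
    and al_ratio: "\<And>i. (\<lambda>t. alpha i t / al t) \<longlonglongrightarrow> 1"
    and al_diff: "(\<lambda>t. 1 / al (Suc t) - 1 / al t) \<longlonglongrightarrow> alpha0"
    and f_lim: "(\<lambda>t. Max (range (\<lambda>i. f i t)) / al t powr delta) \<longlonglongrightarrow> 0"
    and noise: "\<And>p r. summable (\<lambda>t. al (Suc t) powr (- delta) * alpha (fst p) t * D t $ p $ r * V t $ r)"
    and h: "0 < h" and lam: "0 < lam"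
    and Q_le: "\<And>t p q. \<bar>Q t $ p $ q\<bar> \<le> K"
    and C_le: "\<And>m p q. \<bar>C m $ p $ q\<bar> \<le> real h * K"
    and dev: "\<And>p q. summable (\<lambda>m. al (m * h) * ((\<Sum>t\<in>{m*h..<m*h+h}. Q t $ p $ q) - C m $ p $ q))"
    and C_ge: "\<And>m y. (lam + real h * alpha0 * delta) * (norm y)\<^sup>2 \<le> y \<bullet> (C m *v y)"
  shows "(\<lambda>t. (1 / al t powr delta) *\<^sub>R ((\<chi> p. x t (fst p) $ snd p) - (\<chi> p. theta $ snd p)
        :: real^('n \<times> 'm))) \<longlonglongrightarrow> 0"
proof -
  define E :: "nat \<Rightarrow> real^('n \<times> 'm)" where "E t = (\<chi> p. x t (fst p) $ snd p) - (\<chi> p. theta $ snd p)" for t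
  define z where "z t = (1 / al t powr delta) *\<^sub>R E t" for t
  \<comment> \<open>Excitation concerns the symmetrised Laplacian, the dynamics the original one.
    Their difference is constant and skew, so it enters \<open>B\<close> and
    \<open>\<Lambda>\<close> alike, cancels in \<open>B t - \<Lambda> t\<close> and is invisible to
    the quadratic form.\<close>
  define skew :: "real^('n \<times> 'm)^('n \<times> 'm)" where
    "skew = kron (laplacian a) (mat 1) - kron (sym_laplacian a) (mat 1)"
  define S where "S = skew - (alpha0 * delta) *\<^sub>R mat 1"
  define B where "B t = Q t + S" for t
  define \<Lambda> where "\<Lambda> t = (1 / real h) *\<^sub>R C (t div h) + S" for t
  define \<rho> where "\<rho> t = (al t / al (Suc t)) powr delta" for t
  define c where "c i t = al (Suc t) powr (- delta) * alpha i t" for i t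
  define n :: "nat \<Rightarrow> real^('n \<times> 'm)" where "n t = (\<chi> p. c (fst p) t * (D t *v V t) $ p)" for t
  \<comment> \<open>As the defect of the desired recursion, \<open>r\<close> makes that recursion
    true by definition; the work lies in bounding its components.\<close>
  define r where "r t = z (Suc t) - z t + al t *\<^sub>R (B t *v z t) - n t" for t
  define N where "N = real CARD('n \<times> 'm)"
  note \<rho>_lim = scaling_ratio_asymptotics[OF al(1,2) al_diff, of delta, folded \<rho>_def]

  have Q_norm: "norm (Q t) \<le> N * (N * K)" for t
    unfolding N_def by (rule norm_matrix_le_entries) (rule Q_le)
  have C_norm: "norm ((1 / real h) *\<^sub>R C m) \<le> N * (N * K)" for m
    unfolding N_def by (rule norm_matrix_le_entries) (use C_le h in \<open>simp add: field_simps\<close>)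
  \<comment> \<open>The summand \<open>norm skew\<close> lets \<open>L\<close> also dominate
    \<open>A = Q t + skew\<close> in the remainder estimate.\<close>
  define L where "L = N * (N * K) + norm S + norm (skew)"
  have B_norm: "norm (B t) \<le> L" for t
    unfolding B_def L_def using norm_triangle_ineq[of "Q t" S] Q_norm[of t] norm_ge_zero[of skew] by linarith
  have \<Lambda>_norm: "norm (\<Lambda> t) \<le> L" for t
    unfolding \<Lambda>_def L_def
    using norm_triangle_ineq[of "(1 / real h) *\<^sub>R C (t div h)" S] C_norm[of "t div h"] norm_ge_zero[of skew] by linarith

  have n_summable: "summable n"
  proof (rule summable_vec)
    fix p
    have "summable (\<lambda>t. \<Sum>r\<in>UNIV. al (Suc t) powr (- delta) * alpha (fst p) t * D t $ p $ r * V t $ r)"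
      by (rule summable_sum) (rule noise)
    then show "summable (\<lambda>t. n t $ p)"
      by (simp add: n_def c_def matrix_vector_mult_def sum_distrib_left mult.assoc)
  qed

  have transpose_skew: "transpose skew = - skew"
    by (simp add: skew_def kron_def sym_laplacian_def transpose_def vec_eq_iff mat_def field_simps)
  have \<Lambda>_ge: "lam / real h * (norm y)\<^sup>2 \<le> y \<bullet> (\<Lambda> t *v y)" for t y
  proof -
    have "y \<bullet> (\<Lambda> t *v y) = (y \<bullet> (C (t div h) *v y)) / real h + y \<bullet> (skew *v y) - alpha0 * delta * (norm y)\<^sup>2"
      by (simp add: \<Lambda>_def S_def matrix_vector_mult_add_rdistrib matrix_vector_mult_diff_rdistrib
          scaleR_matrix_vector_assoc[symmetric] inner_add_right inner_diff_right power2_norm_eq_inner)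
    moreover have "(lam + real h * alpha0 * delta) * (norm y)\<^sup>2 / real h \<le> (y \<bullet> (C (t div h) *v y)) / real h"
      by (intro divide_right_mono C_ge) simp
    moreover have "(lam + real h * alpha0 * delta) * (norm y)\<^sup>2 / real h
        = lam / real h * (norm y)\<^sup>2 + alpha0 * delta * (norm y)\<^sup>2"
      using h by (simp add: field_simps)
    ultimately show ?thesis using inner_skew_eq_zero[OF transpose_skew, of y] by linarith
  qed

  obtain cc where cc: "\<And>t. \<bar>1 / al (Suc t) - 1 / al t\<bar> \<le> cc"
  proof -
    have "Bseq (\<lambda>t. 1 / al (Suc t) - 1 / al t)" using al_diff by (intro convergent_imp_Bseq) (auto simp: convergent_def)
    then show ?thesis using that by (auto simp: Bseq_def)
  qed
  have diff_summable: "summable (\<lambda>t. al t *\<^sub>R (B t - \<Lambda> t))"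
  proof (intro summable_vec)
    fix p q
    define G where "G t = Q t $ p $ q - C (t div h) $ p $ q / real h" for t
    have "summable (\<lambda>t. al t * G t)"
    proof (rule summable_of_block_sums[OF al(1,2,4) cc _ h])
      show "\<bar>G t\<bar> \<le> 2 * K" for t
      proof -
        have "\<bar>C (t div h) $ p $ q / real h\<bar> \<le> K" using C_le[of "t div h" p q] h by (simp add: field_simps)
        then show ?thesis using Q_le[of t p q] unfolding G_def by linarith
      qed
      have "(\<Sum>t\<in>{m*h..<m*h+h}. G t) = (\<Sum>t\<in>{m*h..<m*h+h}. Q t $ p $ q) - C m $ p $ q" for m
      proof -
        have "(\<Sum>t\<in>{m*h..<m*h+h}. C (t div h) $ p $ q / real h) = (\<Sum>t\<in>{m*h..<m*h+h}. C m $ p $ q / real h)"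
        proof (rule sum.cong[OF refl])
          fix t assume "t \<in> {m*h..<m*h+h}"
          then have "t div h = m" by (intro div_nat_eqI) (auto simp: algebra_simps)
          then show "C (t div h) $ p $ q / real h = C m $ p $ q / real h" by simp
        qed
        then show ?thesis using h by (simp add: G_def sum_subtractf)
      qed
      then show "summable (\<lambda>m. al (m * h) * (\<Sum>t\<in>{m*h..<m*h+h}. G t))" using dev[of p q] by simp
    qed
    then show "summable (\<lambda>t. (al t *\<^sub>R (B t - \<Lambda> t)) $ p $ q)"
      by (simp add: B_def \<Lambda>_def G_def)
  qed

  define F where "F t = Max (range (\<lambda>i. f i t))" for t
  have trig: "norm (xh t j - x t j) \<le> F t" for t j
    using triggering_error_le[of x xh f t j, OF init f xh_step] Max_ge[of "range (\<lambda>i. f i t)" "f j t"]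
    unfolding F_def by (meson finite finite_imageI order_trans rangeI)
  \<comment> \<open>\<open>\<gamma> i t * al t\<close> is the effective step of sensor
    \<open>i\<close> after rescaling: it combines the change of scale from \<open>t\<close> to
    \<open>Suc t\<close> with the sensor's own step size.\<close>
  define \<gamma> where "\<gamma> i t = \<rho> t * (alpha i t / al t)" for i t
  have \<gamma>_lim: "\<gamma> i \<longlonglongrightarrow> 1" for i
    unfolding \<gamma>_def using tendsto_mult[OF \<rho>_lim(1) al_ratio[of i]] by simp
  have \<gamma>_nonneg: "0 \<le> \<gamma> i t" for i t using al(1)[of t] alpha_pos[of i t] by (simp add: \<gamma>_def \<rho>_def less_imp_le)
  \<comment> \<open>Three sources of error relative to \<open>al t\<close>: the scale change beyond
    its linear part, the effective step differing from \<open>al t\<close>, and the triggering error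
    measured against \<open>al t powr delta\<close>.\<close>
  define \<eta> where "\<eta> i t = \<bar>(\<rho> t - 1) / al t - alpha0 * delta\<bar> + \<bar>1 - \<gamma> i t\<bar> * L
      + \<gamma> i t * ((\<Sum>j\<in>UNIV. a i j) * (F t / al t powr delta))" for i t
  have \<eta>_lim: "\<eta> i \<longlonglongrightarrow> 0" for i
  proof -
    have "\<eta> i \<longlonglongrightarrow> \<bar>alpha0 * delta - alpha0 * delta\<bar> + \<bar>1 - 1\<bar> * L + 1 * ((\<Sum>j\<in>UNIV. a i j) * 0)"
      unfolding \<eta>_def using f_lim \<rho>_lim(2) \<gamma>_lim[of i] by (intro tendsto_intros) (simp_all add: F_def)
    then show ?thesis by simp
  qed
  have r_comp: "\<bar>r t $ p\<bar> \<le> \<eta> (fst p) t * al t * (1 + norm (z t))" for t p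
  proof -
    obtain i k where p: "p = (i, k)" by fastforce
    define A where "A = Q t + skew"
    define w where "w = (\<Sum>j\<in>UNIV. a i j * (xh t j $ k - x t j $ k))"
    have pos: "0 < al t" "0 < al (Suc t)" by (rule al(1))+
    have A_eq: "A = kron (laplacian a) (mat 1) + D t ** transpose (D t)" by (simp add: A_def Q_def skew_def)
    have zE: "E t = al t powr delta *\<^sub>R z t"
      using pos by (simp add: z_def)
    have sc: "al (Suc t) powr (- delta) * al t powr delta = \<rho> t"
      using pos by (simp add: \<rho>_def powr_divide powr_minus field_simps)
    have ct: "c i t * al t powr delta = \<gamma> i t * al t"
      using pos sc by (simp add: c_def \<gamma>_def field_simps)
    have "z (Suc t) $ p = al (Suc t) powr (- delta) * E (Suc t) $ (i, k)"
      using pos by (simp add: z_def p powr_minus field_simps)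
    also have "E (Suc t) $ (i, k) = E t $ (i, k) - alpha i t * ((A *v E t) $ (i, k))
        + alpha i t * ((D t *v V t) $ (i, k)) + alpha i t * w"
      unfolding w_def A_eq D_def by (rule error_recursion[where a=a and x=x and xh=xh and theta=theta and own=own and H="H t" and v="V t" and E=E and t=t and i=i and alpha="alpha i t", OF a x_step[of t i] E_def])
    also have "al (Suc t) powr (- delta) * \<dots> = \<rho> t * z t $ p - \<gamma> i t * al t * (A *v z t) $ p
        + n t $ p + c i t * w"
      unfolding zE matrix_vector_mult_scaleR sc[symmetric] ct[symmetric]
      by (simp add: p n_def c_def algebra_simps)
    finally have z_eq: "z (Suc t) $ p = \<rho> t * z t $ p - \<gamma> i t * al t * (A *v z t) $ p + n t $ p + c i t * w" .
    have Bz: "(B t *v z t) $ p = (A *v z t) $ p - alpha0 * delta * z t $ p"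
      by (simp add: B_def S_def A_def matrix_vector_mult_add_rdistrib matrix_vector_mult_diff_rdistrib
          scaleR_matrix_vector_assoc[symmetric])
    have r_eq: "r t $ p = ((\<rho> t - 1) / al t - alpha0 * delta) * al t * z t $ p
        + (1 - \<gamma> i t) * al t * (A *v z t) $ p + c i t * w"
      using pos by (simp add: r_def z_eq Bz field_simps)
    have "\<bar>((\<rho> t - 1) / al t - alpha0 * delta) * al t * z t $ p\<bar>
        \<le> \<bar>(\<rho> t - 1) / al t - alpha0 * delta\<bar> * al t * (1 + norm (z t))"
      unfolding abs_mult using pos component_le_norm_cart[of "z t" p] by (intro mult_mono) auto
    moreover have "\<bar>(1 - \<gamma> i t) * al t * (A *v z t) $ p\<bar> \<le> \<bar>1 - \<gamma> i t\<bar> * al t * (L * (1 + norm (z t)))"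
    proof -
      have "norm A \<le> L"
        unfolding A_def L_def using norm_triangle_ineq[of "Q t" skew] Q_norm[of t] norm_ge_zero[of S] by linarith
      then have "norm (A *v z t) \<le> L * (1 + norm (z t))"
        by (intro order_trans[OF norm_matrix_vector_mult_le] mult_mono) (auto intro: order_trans[OF norm_ge_zero])
      then have "\<bar>(A *v z t) $ p\<bar> \<le> L * (1 + norm (z t))" using component_le_norm_cart order_trans by blast
      then show ?thesis unfolding abs_mult using pos by (intro mult_mono) auto
    qed
    moreover have "\<bar>c i t * w\<bar> \<le> \<gamma> i t * ((\<Sum>j\<in>UNIV. a i j) * (F t / al t powr delta)) * al t * (1 + norm (z t))"
    proof -
      have "\<bar>w\<bar> \<le> (\<Sum>j\<in>UNIV. a i j * F t)"
        unfolding w_def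
      proof (rule order_trans[OF sum_abs sum_mono])
        fix j
        have "\<bar>xh t j $ k - x t j $ k\<bar> \<le> F t"
          using component_le_norm_cart[of "xh t j - x t j" k] trig[of t j] by simp
        then show "\<bar>a i j * (xh t j $ k - x t j $ k)\<bar> \<le> a i j * F t"
          using a[of i j] by (simp add: abs_mult mult_left_mono)
      qed
      then have w_le: "\<bar>w\<bar> \<le> (\<Sum>j\<in>UNIV. a i j) * F t" by (simp add: sum_distrib_right)
      have c_eq: "c i t = \<gamma> i t * al t / al t powr delta" using ct pos by (simp add: field_simps)
      have c_nonneg: "0 \<le> c i t" using alpha_pos[of i t] by (simp add: c_def less_imp_le)
      have "\<bar>c i t * w\<bar> \<le> c i t * ((\<Sum>j\<in>UNIV. a i j) * F t)"
        using w_le c_nonneg by (simp add: abs_mult mult_left_mono)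
      also have "\<dots> = \<gamma> i t * ((\<Sum>j\<in>UNIV. a i j) * (F t / al t powr delta)) * al t"
        by (simp add: c_eq)
      finally have 1: "\<bar>c i t * w\<bar> \<le> \<gamma> i t * ((\<Sum>j\<in>UNIV. a i j) * (F t / al t powr delta)) * al t" .
      moreover have "\<dots> * 1 \<le> \<dots> * (1 + norm (z t))"
        using order_trans[OF abs_ge_zero 1] by (intro mult_left_mono) auto
      ultimately show ?thesis by simp
    qed
    ultimately have "\<bar>r t $ p\<bar> \<le> \<bar>(\<rho> t - 1) / al t - alpha0 * delta\<bar> * al t * (1 + norm (z t))
        + \<bar>1 - \<gamma> i t\<bar> * al t * (L * (1 + norm (z t)))
        + \<gamma> i t * ((\<Sum>j\<in>UNIV. a i j) * (F t / al t powr delta)) * al t * (1 + norm (z t))"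
      unfolding r_eq by linarith
    then show ?thesis by (simp add: \<eta>_def p algebra_simps)
  qed
  define \<epsilon> where "\<epsilon> t = (\<Sum>p\<in>(UNIV :: ('n \<times> 'm) set). \<eta> (fst p) t)" for t
  have "\<epsilon> \<longlonglongrightarrow> (\<Sum>p\<in>(UNIV :: ('n \<times> 'm) set). 0)" unfolding \<epsilon>_def by (intro tendsto_sum \<eta>_lim)
  then have \<epsilon>: "\<epsilon> \<longlonglongrightarrow> 0" by simp
  have r_le: "norm (r t) \<le> \<epsilon> t * al t * (1 + norm (z t))" for t
  proof -
    have "norm (r t) \<le> (\<Sum>p\<in>UNIV. \<bar>r t $ p\<bar>)" by (rule norm_le_l1_cart)
    also have "\<dots> \<le> (\<Sum>p\<in>(UNIV :: ('n \<times> 'm) set). \<eta> (fst p) t * al t * (1 + norm (z t)))" by (intro sum_mono r_comp)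
    finally show ?thesis by (simp add: \<epsilon>_def sum_distrib_right)
  qed
  have z_step: "z (Suc t) = z t - al t *\<^sub>R (B t *v z t) + n t + r t" for t by (simp add: r_def)
  have "0 < lam / real h" using lam h by simp
  then have "z \<longlonglongrightarrow> 0"
    using perturbed_recursion_tendsto_zero[OF al(1-3) z_step n_summable r_le \<epsilon> B_norm \<Lambda>_norm diff_summable _ \<Lambda>_ge]
    by blast
  then show ?thesis by (simp add: z_def[abs_def] E_def)
qed

section \<open>Almost-sure convergence\<close>

lemma borel_measurable_vec_nth:
  fixes f :: "'a \<Rightarrow> real^'k"
  assumes "f \<in> borel_measurable N"
  shows "(\<lambda>\<omega>. f \<omega> $ i) \<in> borel_measurable N"
  by (intro measurable_compose[OF assms] borel_measurable_continuous_onI continuous_intros)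

lemma borel_measurable_matrix_nth:
  fixes f :: "'a \<Rightarrow> real^'c^'r"
  assumes "f \<in> borel_measurable N"
  shows "(\<lambda>\<omega>. f \<omega> $ p $ q) \<in> borel_measurable N"
  by (intro measurable_compose[OF assms] borel_measurable_continuous_onI continuous_intros)

lemma borel_measurable_matrixI:
  fixes f :: "'a \<Rightarrow> real^'c^'r"
  assumes "\<And>p q. (\<lambda>\<omega>. f \<omega> $ p $ q) \<in> borel_measurable N"
  shows "f \<in> borel_measurable N"
  by (rule borel_measurable_euclidean_space[THEN iffD2]) (auto simp: Basis_vec_def inner_axis assms)

lemma borel_measurable_DH_mat:
  assumes "\<And>r. Hr r \<in> borel_measurable N"
  shows "(\<lambda>\<omega>. DH_mat own (\<lambda>r. Hr r \<omega>)) \<in> borel_measurable N"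
proof (rule borel_measurable_matrixI)
  fix p q
  show "(\<lambda>\<omega>. DH_mat own (\<lambda>r. Hr r \<omega>) $ p $ q) \<in> borel_measurable N"
    using borel_measurable_vec_nth[OF assms, of q "snd p"] by (simp add: DH_mat_def)
qed

lemma square_entry_le_mat_norm:
  fixes A :: "real^'c^'r"
  shows "(A $ p $ q)\<^sup>2 \<le> (mat_norm A)\<^sup>2"
  using matrix_component_le_onorm[of A p q]
  by (simp add: mat_norm_def abs_le_square_iff[symmetric] onorm_pos_le)

lemma abs_gram_entry_le:
  fixes A :: "real^'c^'r"
  shows "\<bar>(A ** transpose A) $ p $ q\<bar> \<le> real CARD('c) * (mat_norm A)\<^sup>2"
proof -
  have "(A ** transpose A) $ p $ q = (\<Sum>r\<in>UNIV. A $ p $ r * A $ q $ r)"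
    by (simp add: matrix_matrix_mult_def transpose_def)
  also have "\<bar>\<dots>\<bar> \<le> (\<Sum>r\<in>(UNIV :: 'c set). (mat_norm A)\<^sup>2)"
  proof (rule order_trans[OF sum_abs sum_mono])
    fix r
    have "2 * (\<bar>A $ p $ r\<bar> * \<bar>A $ q $ r\<bar>) \<le> (A $ p $ r)\<^sup>2 + (A $ q $ r)\<^sup>2"
      using sum_squares_bound[of "\<bar>A $ p $ r\<bar>" "\<bar>A $ q $ r\<bar>"] by (simp add: mult.assoc)
    then show "\<bar>A $ p $ r * A $ q $ r\<bar> \<le> (mat_norm A)\<^sup>2"
      unfolding abs_mult using square_entry_le_mat_norm[of A p r] square_entry_le_mat_norm[of A q r] by linarith
  qed
  finally show ?thesis by simp
qed

theorem theorem2: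
  fixes M :: "'a measure"
    and a :: "'n::finite \<Rightarrow> 'n \<Rightarrow> real"
    and own :: "'r::finite \<Rightarrow> 'n"
    and theta :: "real^'m::finite"
    and Hr :: "nat \<Rightarrow> 'r \<Rightarrow> 'a \<Rightarrow> real^'m"
    and V :: "nat \<Rightarrow> 'a \<Rightarrow> real^'r"
    and x xh :: "nat \<Rightarrow> 'a \<Rightarrow> 'n \<Rightarrow> real^'m"
    and x0 :: "'n \<Rightarrow> real^'m"
    and alpha :: "'n \<Rightarrow> nat \<Rightarrow> real"
    and f :: "'n \<Rightarrow> nat \<Rightarrow> real"
    and al :: "nat \<Rightarrow> real"
    and alpha0 delta rho cV Dbd lam :: real
    and h :: nat
  assumes prob: "prob_space M"
    and a_nonneg: "\<And>i j. a i j \<ge> 0"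
    and a_diag: "\<And>i. a i i = 0"
    and own_surj: "surj own"
    and Hr_meas: "\<And>t r. Hr t r \<in> borel_measurable M"
    and V_meas: "\<And>t. V t \<in> borel_measurable M"
    and alpha_pos: "\<And>i t. alpha i t > 0"
    and f_nonneg: "\<And>i t. f i t \<ge> 0"
    \<comment> \<open>the algorithm\<close>
    and x_init: "\<And>\<omega>. x 0 \<omega> = x0"
    and xh_init: "\<And>\<omega>. xh 0 \<omega> = x0"
    and xh_step: "\<And>t \<omega> i. xh (Suc t) \<omega> i =
        (if norm (x (Suc t) \<omega> i - xh t \<omega> i) > f i (Suc t) then x (Suc t) \<omega> i else xh t \<omega> i)"
    and x_step: "\<And>t \<omega> i. x (Suc t) \<omega> i = x t \<omega> i
        + alpha i t *\<^sub>R (\<Sum>r\<in>{r. own r = i}.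
             ((Hr t r \<omega> \<bullet> theta + V t \<omega> $ r) - Hr t r \<omega> \<bullet> x t \<omega> i) *\<^sub>R Hr t r \<omega>)
        + alpha i t *\<^sub>R (\<Sum>j\<in>{j. a i j > 0}. a i j *\<^sub>R (xh t \<omega> j - x t \<omega> i))"
    \<comment> \<open>common delta\<close>
    and delta: "0 \<le> delta" "delta < 1/2"
    \<comment> \<open>(i.a)\<close>
    and al_ratio: "\<And>i. (\<lambda>t. alpha i t / al t) \<longlonglongrightarrow> 1"
    and al_pos: "\<And>t. al t > 0"
    and al_lim: "al \<longlonglongrightarrow> 0"
    and al_nsum: "\<not> summable al"
    and al_diff: "(\<lambda>t. 1 / al (Suc t) - 1 / al t) \<longlonglongrightarrow> alpha0"
    and alpha0: "alpha0 \<ge> 0"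
    \<comment> \<open>(i.b)\<close>
    and al_sq: "summable (\<lambda>t. al t powr (2 * (1 - delta)))"
    \<comment> \<open>(ii.a)\<close>
    and indep: "prob_space.indep_set M
        {(\<lambda>\<omega> t. DH_mat own (\<lambda>r. Hr t r \<omega>)) -` A \<inter> space M | A. A \<in> sets (PiM UNIV (\<lambda>_. borel))}
        {(\<lambda>\<omega> t. V t \<omega>) -` B \<inter> space M | B. B \<in> sets (PiM UNIV (\<lambda>_. borel))}"
    \<comment> \<open>(ii.b)\<close>
    and mds_int: "\<And>t r. integrable M (\<lambda>\<omega>. V t \<omega> $ r)"
    and mds: "\<And>t r. AE \<omega> in M. real_cond_exp M
        (pre_filt M (\<lambda>s \<omega>. DH_mat own (\<lambda>r. Hr s r \<omega>)) V t) (\<lambda>\<omega>. V t \<omega> $ r) \<omega> = 0"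
    and rho: "rho > 2"
    and moment: "AE \<omega> in M. \<forall>t. nn_cond_exp M
        (pre_filt M (\<lambda>s \<omega>. DH_mat own (\<lambda>r. Hr s r \<omega>)) V t)
        (\<lambda>\<omega>. ennreal (norm (V t \<omega>) powr rho)) \<omega> \<le> ennreal cV"
    \<comment> \<open>(ii.c)\<close>
    and DH_bound: "AE \<omega> in M. \<forall>t. (mat_norm (DH_mat own (\<lambda>r. Hr t r \<omega>)))\<^sup>2 \<le> Dbd"
    and h_pos: "h \<ge> 1"
    and lam_pos: "lam > 0"
    and excitation: "\<And>m. AE \<omega> in M. lambda_min
        (\<Sum>t\<in>{m*h..<(m+1)*h}. cond_exp_mat M
            (pre_filt M (\<lambda>s \<omega>. DH_mat own (\<lambda>r. Hr s r \<omega>)) V (m*h))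
            (\<lambda>\<omega>. kron (sym_laplacian a) (mat 1)
                 + DH_mat own (\<lambda>r. Hr t r \<omega>) ** transpose (DH_mat own (\<lambda>r. Hr t r \<omega>))) \<omega>)
        \<ge> lam + real h * alpha0 * delta"
    \<comment> \<open>(iii.a), (iii.b)\<close>
    and f_lim: "(\<lambda>t. Max (range (\<lambda>i. f i t)) / al t powr delta) \<longlonglongrightarrow> 0"
    and f_sum: "summable (\<lambda>t. al t powr (1 - delta) * Max (range (\<lambda>i. f i t)))"
  shows "AE \<omega> in M.
    (\<lambda>t. (1 / al t powr delta) *\<^sub>R ((\<chi> p. x t \<omega> (fst p) $ snd p) - (\<chi> p. theta $ snd p)
        :: real^('n \<times> 'm))) \<longlonglongrightarrow> 0"
proof -
  interpret prob_space M by (rule prob)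
  define D where "D = (\<lambda>t \<omega>. DH_mat own (\<lambda>r. Hr t r \<omega>))"
  define Q where "Q = (\<lambda>t \<omega>. kron (sym_laplacian a) (mat 1) + D t \<omega> ** transpose (D t \<omega>))"
  define P where "P = pre_filt M D V"
  define C where "C m \<omega> = (\<Sum>t\<in>{m*h..<(m+1)*h}. cond_exp_mat M (P (m*h)) (Q t) \<omega>)" for m \<omega>
  \<comment> \<open>The constant part is bounded by its Frobenius norm, the Gram part by one
    \<open>Dbd\<close> per measurement row; the same \<open>K\<close> then bounds the conditional
    expectations.\<close>
  define K where "K = norm (kron (sym_laplacian a) (mat 1 :: real^'m^'m)) + real CARD('r) * Dbd"
  have h: "0 < h" using h_pos by simp
  have al_sq2: "summable (\<lambda>t. (al t)\<^sup>2)"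
    by (rule summable_square_of_powr[OF al_pos al_lim delta(1) al_sq])
  have D_meas: "D t \<in> borel_measurable M" for t
    unfolding D_def by (intro borel_measurable_DH_mat Hr_meas)
  have P: "subalgebra M (P t)" for t
    unfolding P_def by (intro subalgebra_pre_filt D_meas V_meas)
  have Q_meas: "(\<lambda>\<omega>. Q t \<omega> $ p $ q) \<in> borel_measurable (P s)" if "t < s" for t s p q
  proof -
    have "(\<lambda>\<omega>. D t \<omega> $ i $ j) \<in> borel_measurable (P s)" for i j
      unfolding P_def by (intro borel_measurable_matrix_nth measurable_pre_filt that)
    then show ?thesis
      unfolding Q_def by (simp add: matrix_matrix_mult_def transpose_def)
  qed
  have Q_bound: "AE \<omega> in M. \<forall>t p q. \<bar>Q t \<omega> $ p $ q\<bar> \<le> K"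
    using DH_bound
  proof eventually_elim
    case (elim \<omega>)
    show ?case
    proof (intro allI)
      fix t p q
      let ?k = "kron (sym_laplacian a) (mat 1 :: real^'m^'m)"
      have "\<bar>?k $ p $ q\<bar> \<le> norm ?k"
        using component_le_norm_cart[of "?k $ p" q] Finite_Cartesian_Product.norm_nth_le[of ?k p] by linarith
      moreover have "\<bar>(D t \<omega> ** transpose (D t \<omega>)) $ p $ q\<bar> \<le> real CARD('r) * Dbd"
        using elim by (intro order_trans[OF abs_gram_entry_le mult_left_mono]) (auto simp: D_def)
      ultimately show "\<bar>Q t \<omega> $ p $ q\<bar> \<le> K"
        unfolding Q_def K_def by simp
    qed
  qed
  have C_entry: "C m \<omega> $ p $ q = (\<Sum>t\<in>{m*h..<m*h+h}. real_cond_exp M (P (m*h)) (\<lambda>\<omega>. Q t \<omega> $ p $ q) \<omega>)" for m \<omega> p q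
    by (simp add: C_def cond_exp_mat_def add.commute)
  have C_bound: "AE \<omega> in M. \<forall>m p q. \<bar>C m \<omega> $ p $ q\<bar> \<le> real h * K"
  proof -
    have "AE \<omega> in M. \<bar>real_cond_exp M (P (m*h)) (\<lambda>\<omega>. Q t \<omega> $ p $ q) \<omega>\<bar> \<le> K" for m t p q
    proof (rule AE_abs_real_cond_exp_le[OF P measurable_from_subalg[OF P Q_meas[OF lessI]]])
      show "AE \<omega> in M. \<bar>Q t \<omega> $ p $ q\<bar> \<le> K" using Q_bound by eventually_elim blast
    qed
    then have "AE \<omega> in M. \<forall>m t p q. \<bar>real_cond_exp M (P (m*h)) (\<lambda>\<omega>. Q t \<omega> $ p $ q) \<omega>\<bar> \<le> K"
      unfolding AE_all_countable by blast
    then show ?thesis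
    proof eventually_elim
      case (elim \<omega>)
      show ?case
      proof (intro allI)
        fix m p q
        have "\<bar>C m \<omega> $ p $ q\<bar> \<le> (\<Sum>t\<in>{m*h..<m*h+h}. K)"
          unfolding C_entry by (rule order_trans[OF sum_abs sum_mono]) (use elim in blast)
        then show "\<bar>C m \<omega> $ p $ q\<bar> \<le> real h * K" by simp
      qed
    qed
  qed
  have dev: "AE \<omega> in M. \<forall>p q. summable (\<lambda>m. al (m * h) * ((\<Sum>t\<in>{m*h..<m*h+h}. Q t \<omega> $ p $ q) - C m \<omega> $ p $ q))"
  proof -
    have "summable (\<lambda>m. (al (m * h))\<^sup>2)"
      using summable_reindex[OF al_sq2, of "\<lambda>m. m * h"] h by (simp add: inj_on_def comp_def)
    then have "AE \<omega> in M. summable (\<lambda>m. al (m * h) *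
        (\<Sum>t\<in>{m*h..<m*h+h}. Q t \<omega> $ p $ q - real_cond_exp M (P (m*h)) (\<lambda>\<omega>. Q t \<omega> $ p $ q) \<omega>))" for p q
    proof (rule AE_summable_block_deviations[OF P _ Q_meas _, rotated 3])
      show "AE \<omega> in M. \<bar>Q t \<omega> $ p $ q\<bar> \<le> K" for t using Q_bound by eventually_elim blast
      show "subalgebra (P t) (P s)" if "s \<le> t" for s t
        unfolding P_def by (rule subalgebra_pre_filt_mono[OF that])
    qed
    then show ?thesis
      unfolding AE_all_countable C_entry sum_subtractf by blast
  qed
  have C_ge: "AE \<omega> in M. \<forall>m y. (lam + real h * alpha0 * delta) * (norm y)\<^sup>2 \<le> y \<bullet> (C m \<omega> *v y)"
  proof -
    \<comment> \<open>Null sets are collected over \<open>m\<close> only; the uncountably many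
      \<open>y\<close> are handled on each path through the eigenvalue.\<close>
    have "AE \<omega> in M. lambda_min (C m \<omega>) \<ge> lam + real h * alpha0 * delta" for m
      using excitation[of m] by (simp only: C_def Q_def D_def P_def)
    then have "AE \<omega> in M. \<forall>m. lambda_min (C m \<omega>) \<ge> lam + real h * alpha0 * delta"
      unfolding AE_all_countable by blast
    then show ?thesis
    proof eventually_elim
      case (elim \<omega>)
      show ?case
      proof (intro allI)
        fix m y
        \<comment> \<open>Mirrored entries agree as functions on the sample space, so their
          conditional expectations are the same function and \<open>C m \<omega>\<close> is
          symmetric on every path.\<close>
        have "Q t \<omega> $ q $ p = Q t \<omega> $ p $ q" for t \<omega> p q
          by (simp add: Q_def kron_def sym_laplacian_def transpose_def mat_def matrix_matrix_mult_def
              add.commute mult.commute)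
        then have "transpose (C m \<omega>) = C m \<omega>"
          by (simp add: vec_eq_iff transpose_def C_entry)
        from quadratic_form_ge_lambda_min[OF this, of y]
        show "(lam + real h * alpha0 * delta) * (norm y)\<^sup>2 \<le> y \<bullet> (C m \<omega> *v y)"
          using mult_right_mono[OF elim[rule_format, of m], of "(norm y)\<^sup>2"] by simp
      qed
    qed
  qed
  have noise: "AE \<omega> in M. \<forall>p r. summable (\<lambda>t. al (Suc t) powr (- delta) * alpha (fst p) t * D t \<omega> $ p $ r * V t \<omega> $ r)"
  proof -
    have "AE \<omega> in M. summable (\<lambda>t. (al (Suc t) powr (- delta) * alpha (fst p) t) * D t \<omega> $ p $ r * V t \<omega> $ r)"
      for p :: "'n \<times> 'm" and r
    proof (rule AE_summable_independent_multiplier[OF D_meas V_meas, where F = P and K = "sqrt Dbd"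
          and C = "1 + \<bar>cV\<bar>" and \<phi> = "\<lambda>A. A $ p $ r" and \<psi> = "\<lambda>v. v $ r"])
      show "indep_set {(\<lambda>\<omega> t. D t \<omega>) -` A \<inter> space M | A. A \<in> sets (PiM UNIV (\<lambda>_. borel))}
          {(\<lambda>\<omega> t. V t \<omega>) -` B \<inter> space M | B. B \<in> sets (PiM UNIV (\<lambda>_. borel))}"
        using indep unfolding D_def .
      show "AE \<omega> in M. \<forall>t. \<bar>D t \<omega> $ p $ r\<bar> \<le> sqrt Dbd"
        using DH_bound
      proof eventually_elim
        case (elim \<omega>)
        have "(D t \<omega> $ p $ r)\<^sup>2 \<le> Dbd" for t
          using square_entry_le_mat_norm[of "D t \<omega>" p r] elim unfolding D_def by (blast intro: order_trans)
        then show ?case by (metis real_sqrt_abs real_sqrt_le_iff)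
      qed
      have "AE \<omega> in M. nn_cond_exp M (P t) (\<lambda>\<omega>. ennreal (norm (V t \<omega>) powr rho)) \<omega> \<le> ennreal cV" for t
        using moment unfolding D_def P_def AE_all_countable by blast
      note V_sq = square_integrable_of_cond_moment[OF P V_meas less_imp_le[OF rho] this]
      show "mds M (\<lambda>t \<omega>. V t \<omega> $ r) P"
      proof
        show "subalgebra M (P t)" for t by (rule P)
        show "(\<lambda>\<omega>. V t \<omega> $ r) \<in> borel_measurable M" for t by (intro borel_measurable_vec_nth V_meas)
        show "(\<lambda>\<omega>. V s \<omega> $ r) \<in> borel_measurable (P t)" if "s < t" for s t
          unfolding P_def by (intro borel_measurable_vec_nth measurable_pre_filt that)
        show "integrable M (\<lambda>\<omega>. (V t \<omega> $ r)\<^sup>2)" for t by (rule V_sq)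
        show "AE \<omega> in M. real_cond_exp M (P t) (\<lambda>\<omega>. V t \<omega> $ r) \<omega> = 0" for t
          using mds unfolding D_def P_def .
      qed
      show "expectation (\<lambda>\<omega>. (V t \<omega> $ r)\<^sup>2) \<le> 1 + \<bar>cV\<bar>" for t by (rule V_sq)
      show "(\<lambda>A :: real^'r^('n \<times> 'm). A $ p $ r) \<in> borel_measurable borel" by (rule borel_measurable_matrix_nth) simp
      show "(\<lambda>v :: real^'r. v $ r) \<in> borel_measurable borel" by (rule borel_measurable_vec_nth) simp
      show "summable (\<lambda>t. (al (Suc t) powr (- delta) * alpha (fst p) t)\<^sup>2)"
      proof -
        \<comment> \<open>\<open>g\<close> is the noise multiplier divided by
          \<open>al t powr (1 - delta)\<close>. It converges, hence is bounded, so the squared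
          multipliers are dominated by the summable powers of \<open>al\<close> with exponent
          \<open>2 * (1 - delta)\<close>.\<close>
        define g where "g t = (al t / al (Suc t)) powr delta * (alpha (fst p) t / al t)" for t
        have "g \<longlonglongrightarrow> 1 * 1"
          unfolding g_def by (intro tendsto_mult scaling_ratio_asymptotics(1)[OF al_pos al_lim al_diff] al_ratio)
        then have "Bseq g" by (intro convergent_imp_Bseq) (auto simp: convergent_def)
        then obtain b where b: "\<And>t. \<bar>g t\<bar> \<le> b" by (auto simp: Bseq_def)
        show ?thesis
        proof (rule summable_comparison_test')
          show "summable (\<lambda>t. b\<^sup>2 * al t powr (2 * (1 - delta)))" by (intro summable_mult al_sq)
          fix t
          have "al t powr (1 - delta) = al t / al t powr delta"
            using al_pos[of t] by (simp add: powr_diff)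
          then have eq: "al (Suc t) powr (- delta) * alpha (fst p) t = g t * al t powr (1 - delta)"
            using al_pos[of t] al_pos[of "Suc t"] by (simp add: g_def powr_divide powr_minus field_simps)
          have sq: "(al t powr (1 - delta))\<^sup>2 = al t powr (2 * (1 - delta))"
            using al_pos[of t] by (simp add: power2_eq_square flip: powr_add)
          have "(g t)\<^sup>2 \<le> b\<^sup>2" using power_mono[OF b[of t] abs_ge_zero, of 2] by simp
          then show "norm ((al (Suc t) powr (- delta) * alpha (fst p) t)\<^sup>2) \<le> b\<^sup>2 * al t powr (2 * (1 - delta))"
            unfolding eq power_mult_distrib sq by (simp add: mult_right_mono)
        qed
      qed
    qed
    then show ?thesis unfolding AE_all_countable by blast
  qed
  from Q_bound C_bound dev C_ge noise show ?thesis
  proof eventually_elim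
    case (elim \<omega>)
    note bounds = elim[unfolded Q_def D_def]
    show ?case
    proof (rule scaled_error_tendsto_zero[where a = a and own = own and H = "\<lambda>t r. Hr t r \<omega>" and V = "\<lambda>t. V t \<omega>"
          and x = "\<lambda>t. x t \<omega>" and xh = "\<lambda>t. xh t \<omega>" and alpha = alpha and f = f and C = "\<lambda>m. C m \<omega>" and al = al
          and ?alpha0.0 = alpha0 and delta = delta and theta = theta and h = h and K = K and lam = lam,
          OF a_nonneg f_nonneg _ xh_step x_step alpha_pos al_pos al_lim al_nsum al_sq2 al_ratio al_diff f_lim _ h lam_pos])
      show "x 0 \<omega> = xh 0 \<omega>" by (simp add: x_init xh_init)
    qed (use bounds in blast)+
  qed
qed

end
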